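(* Let $(M,g)$ be a spacetime manifold with a chosen spin structure and let $k\in\mathbb{N}$ with $k\ge2$. Then for every nowhere vanishing, future pointing, timelike covector field $\xi\in\Gamma(T^*M)$ the Hermitian product $$(\Phi,\Psi)_\xi=\langle\Phi,s_{\mathcal{T}^{k,k}}(\xi)\Psi\rangle_{\mathscr{M}^{k,k}},\qquad\Phi,\Psi\in\Gamma(\mathscr{M}^{k,k}),$$ is indefinite (in every fiber). Thus $\mathcal{T}^{k,k}$ is of indefinite type with respect to $\langle\cdot,\cdot\rangle_{\mathscr{M}^{k,k}}$.
   Context: A spacetime manifold $(M,g)$ is a 4-dimensional, time-oriented and space-oriented, connected, globally hyperbolic Lorentzian manifold of signature $(+,-,-,-)$ (it then admits a spin structure). $\Gamma$ denotes smooth sections. Spinor bundles: the chosen spin structure is an $SL(2,\mathbb{C})$-principal bundle $\mathscr{S}(M,g)$ with a bundle map to the bundle of oriented, time-oriented pseudo-orthonormal frames that is fiberwise the double cover $\lambda\colon SL(2,\mathbb{C})\to SO^+(1,3)$. For a representation of $SL(2,\mathbb{C})$ one takes the associated vector bundle. Let $\Delta_{+}=\mathbb{C}^2$ carry the defining representation $S\mapsto S$ and $\Delta_-=\overline{\Delta_+}$ the complex conjugate representation $S\mapsto\bar S$, with dual $\Delta_-^*$, $S\mapsto(\bar S^{-1})^{T}$. The associated bundles are $\mathscr{D}^{1/2,0}$ (from $\Delta_+$), $(\mathscr{D}^{0,1/2})^*$ (from $\Delta_-^*$), the Dirac spinor bundle $\mathscr{D}^D=\mathscr{D}^{1/2,0}\oplus(\mathscr{D}^{0,1/2})^*$,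 and $\tilde{\mathscr{D}}^{k/2,l/2}=\mathrm{Sym}^k(\mathscr{D}^{1/2,0})\otimes\mathrm{Sym}^l\big((\mathscr{D}^{0,1/2})^*\big)$. All carry the covariant derivative $\nabla$ induced by the Levi-Civita connection lifted to the spin structure. Undotted upper indices $A$ refer to $\Delta_+$, dotted lower indices $\dot X$ to $\Delta_-^*$. The field $\gamma_a$: with respect to a local section of $\mathscr{S}(M,g)$, the induced pseudo-orthonormal frame of $TM$, and the induced basis of $\mathscr{D}^D$, it has components $$\gamma_0=\tfrac1{\sqrt2}\begin{pmatrix}0&1\\1&0\end{pmatrix},\qquad \gamma_j=\tfrac1{\sqrt2}\begin{pmatrix}0&\tilde\sigma_j\\-\tilde\sigma_j&0\end{pmatrix}\quad(j=1,2,3),$$ in $2\times2$ blocks, $\tilde\sigma_j$ being the Pauli matrices; this is independent of the local section. Higher spin bundles and operators: $\mathscr{M}^{k,k}=\mathscr{D}^D\otimes\tilde{\mathscr{D}}^{k/2,k/2}$ and $\mathcal{T}^{k,k}\Phi=(\gamma^a\otimes\mathrm{Id})\nabla_a\Phi$ (the Dirac operator $\gamma^a\nabla_a$ twisted by $\tilde{\mathscr{D}}^{k/2,k/2}$), with principal symbol $s_{\mathcal{T}^{k,k}}(\xi)=\xi_a\gamma^a\otimes\mathrm{Id}$. Hermitian bundle product: write $\Phi=(\varphi_1,\varphi_2)$, $\Psi=(\psi_1,\psi_2)$ with $\varphi_1,\psi_1\in\Gamma(\mathscr{D}^{1/2,0}\otimes\tilde{\mathscr{D}}^{k/2,k/2})$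 and $\varphi_2,\psi_2\in\Gamma((\mathscr{D}^{0,1/2})^*\otimes\tilde{\mathscr{D}}^{k/2,k/2})$. Complex conjugation exchanges dotted and undotted indices, and $$\langle\Phi,\Psi\rangle_{\mathscr{M}^{k,k}}=(\bar\varphi_2)_{A\,A_1\ldots A_k}{}^{\dot X_1\ldots\dot X_k}(\psi_1)^{A\,A_1\ldots A_k}{}_{\dot X_1\ldots\dot X_k}+(\bar\varphi_1)^{\dot X\,\dot X_1\ldots\dot X_k}{}_{A_1\ldots A_k}(\psi_2)_{\dot X}{}^{A_1\ldots A_k}{}_{\dot X_1\ldots\dot X_k},$$ where repeated indices denote the natural pairings. A first order linear differential operator $\mathcal{P}$ on a bundle $\mathscr{E}$ with Hermitian product $\langle\cdot,\cdot\rangle$ is of indefinite type with respect to $\langle\cdot,\cdot\rangle$ if for every timelike, future directed covector field $\xi$ the form $(\Psi,\Phi)_\xi=\langle\Psi,s_{\mathcal{P}}(\xi)\Phi\rangle$ is indefinite everywhere, i.e. in each fiber it takes both positive and negative values on the diagonal. A covector is timelike/future pointing if the vector corresponding to it via $g$ is. *)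

theory Defs
  imports "HOL-Analysis.Analysis" "HOL-Library.Multiset"
begin

section \<open>Smooth four-manifolds, tangent vectors, covectors\<close>

primrec Ck_on :: "nat \<Rightarrow> ('a::real_normed_vector \<Rightarrow> 'b::real_normed_vector) \<Rightarrow> 'a set \<Rightarrow> bool" where
  "Ck_on 0 f S \<longleftrightarrow> continuous_on S f"
| "Ck_on (Suc n) f S \<longleftrightarrow> (\<forall>x\<in>S. f differentiable (at x)) \<and>
     (\<forall>v. Ck_on n (\<lambda>x. frechet_derivative f (at x) v) S)"

text \<open>Only used on open sets.\<close>

definition smooth_on :: "('a::real_normed_vector \<Rightarrow> 'b::real_normed_vector) \<Rightarrow> 'a set \<Rightarrow> bool" where
  "smooth_on f S \<longleftrightarrow> (\<forall>n. Ck_on n f S)"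

type_synonym 'm chart = "'m set \<times> ('m \<Rightarrow> real^4)"

text \<open>
  A tangent vector at a point is represented by its components in all charts around that point,
  and is zero on all other arguments. The underlying set of the manifold is the whole type.
\<close>

type_synonym 'm tvec = "'m chart \<Rightarrow> real^4"

text \<open>
  The field \<open>time_or\<close> is a timelike vector field and \<open>space_or\<close> a 3-form that vanishes on no
  spacelike orthonormal triple; they represent the time orientation and the space orientation.
\<close>

record 'm spacetime =
  atlas :: "'m chart set"
  metric :: "'m \<Rightarrow> 'm tvec \<Rightarrow> 'm tvec \<Rightarrow> real"
  time_or :: "'m \<Rightarrow> 'm tvec"
  space_or :: "'m \<Rightarrow> 'm tvec \<Rightarrow> 'm tvec \<Rightarrow> 'm tvec \<Rightarrow> real"

definition chart_inv :: "'m chart \<Rightarrow> real^4 \<Rightarrow> 'm" where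
  "chart_inv c = inv_into (fst c) (snd c)"

definition charts_at :: "('m, 'z) spacetime_scheme \<Rightarrow> 'm \<Rightarrow> 'm chart set" where
  "charts_at M p = {c \<in> atlas M. p \<in> fst c}"

definition chart_at :: "('m, 'z) spacetime_scheme \<Rightarrow> 'm \<Rightarrow> 'm chart" where
  "chart_at M p = (SOME c. c \<in> charts_at M p)"

definition smooth_in_chart :: "'m chart \<Rightarrow> 'm set \<Rightarrow> ('m \<Rightarrow> 'b::real_normed_vector) \<Rightarrow> bool" where
  "smooth_in_chart c U f \<longleftrightarrow> smooth_on (f \<circ> chart_inv c) (snd c ` (U \<inter> fst c))"

definition smooth_fun_on ::
  "('m, 'z) spacetime_scheme \<Rightarrow> 'm set \<Rightarrow> ('m \<Rightarrow> 'b::real_normed_vector) \<Rightarrow> bool" where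
  "smooth_fun_on M U f \<longleftrightarrow> (\<forall>c\<in>atlas M. smooth_in_chart c U f)"

definition smooth_manifold :: "('m::topological_space, 'z) spacetime_scheme \<Rightarrow> bool" where
  "smooth_manifold M \<longleftrightarrow>
     (\<forall>c\<in>atlas M. open (fst c) \<and> open (snd c ` fst c) \<and>
        homeomorphism (fst c) (snd c ` fst c) (snd c) (chart_inv c)) \<and>
     (\<forall>p. charts_at M p \<noteq> {}) \<and>
     (\<forall>c\<in>atlas M. \<forall>c'\<in>atlas M. smooth_in_chart c (fst c') (snd c'))"

text \<open>The tangent vector at \<open>p\<close> with components \<open>v\<close> in the chart \<open>c\<close>.\<close>

definition coord_vec :: "('m, 'z) spacetime_scheme \<Rightarrow> 'm chart \<Rightarrow> 'm \<Rightarrow> real^4 \<Rightarrow> 'm tvec" where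
  "coord_vec M c p v = (\<lambda>c'. if c' \<in> charts_at M p
     then frechet_derivative (snd c' \<circ> chart_inv c) (at (snd c p)) v else 0)"

definition tangent_space :: "('m, 'z) spacetime_scheme \<Rightarrow> 'm \<Rightarrow> 'm tvec set" where
  "tangent_space M p = {X. \<forall>c\<in>charts_at M p. X = coord_vec M c p (X c)}"

text \<open>The derivative \<open>df\<^sub>p(X)\<close>; for differentiable \<open>f\<close> it is the same in every chart.\<close>

definition dir_deriv ::
  "('m, 'z) spacetime_scheme \<Rightarrow> 'm \<Rightarrow> 'm tvec \<Rightarrow> ('m \<Rightarrow> 'b::real_normed_vector) \<Rightarrow> 'b" where
  "dir_deriv M p X f = (let c = chart_at M p in
     frechet_derivative (f \<circ> chart_inv c) (at (snd c p)) (X c))"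

definition smooth_vector_field_on ::
  "('m, 'z) spacetime_scheme \<Rightarrow> 'm set \<Rightarrow> ('m \<Rightarrow> 'm tvec) \<Rightarrow> bool" where
  "smooth_vector_field_on M U X \<longleftrightarrow>
     (\<forall>p\<in>U. X p \<in> tangent_space M p) \<and> (\<forall>c\<in>atlas M. smooth_in_chart c U (\<lambda>p. X p c))"

definition linear_at :: "('m, 'z) spacetime_scheme \<Rightarrow> 'm \<Rightarrow> ('m tvec \<Rightarrow> real) \<Rightarrow> bool" where
  "linear_at M p f \<longleftrightarrow> (\<forall>X\<in>tangent_space M p. \<forall>Y\<in>tangent_space M p. \<forall>a b.
     f (\<lambda>c. a *\<^sub>R X c + b *\<^sub>R Y c) = a * f X + b * f Y)"

definition smooth_covector_field ::
  "('m, 'z) spacetime_scheme \<Rightarrow> ('m \<Rightarrow> 'm tvec \<Rightarrow> real) \<Rightarrow> bool" where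
  "smooth_covector_field M \<xi> \<longleftrightarrow> (\<forall>p. linear_at M p (\<xi> p)) \<and>
     (\<forall>c\<in>atlas M. \<forall>v. smooth_in_chart c UNIV (\<lambda>p. \<xi> p (coord_vec M c p v)))"

definition nowhere_vanishing ::
  "('m, 'z) spacetime_scheme \<Rightarrow> ('m \<Rightarrow> 'm tvec \<Rightarrow> real) \<Rightarrow> bool" where
  "nowhere_vanishing M \<xi> \<longleftrightarrow> (\<forall>p. \<exists>X\<in>tangent_space M p. \<xi> p X \<noteq> 0)"


section \<open>Lorentzian geometry in signature \<open>(+,-,-,-)\<close>\<close>

text \<open>
  Frame indices range over the four-element type \<open>4\<close>, whose elements are \<open>0, 1, 2, 3\<close>;
  as a vector index, \<open>0\<close> coincides with \<open>4\<close>.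
\<close>

definition eta :: "4 \<Rightarrow> 4 \<Rightarrow> real" where
  "eta a b = (if a = b then (if a = 0 then 1 else -1) else 0)"

type_synonym 'm frame = "4 \<Rightarrow> 'm tvec"

definition orthonormal_frame :: "('m, 'z) spacetime_scheme \<Rightarrow> 'm \<Rightarrow> 'm frame \<Rightarrow> bool" where
  "orthonormal_frame M p e \<longleftrightarrow>
     (\<forall>a. e a \<in> tangent_space M p) \<and>
     (\<forall>X\<in>tangent_space M p. \<exists>x::real^4. X = (\<lambda>c. \<Sum>a\<in>UNIV. x$a *\<^sub>R e a c)) \<and>
     (\<forall>a b. metric M p (e a) (e b) = eta a b)"

definition lorentz_metric :: "('m, 'z) spacetime_scheme \<Rightarrow> bool" where
  "lorentz_metric M \<longleftrightarrow>
     (\<forall>p. (\<forall>X\<in>tangent_space M p. linear_at M p (metric M p X)) \<and>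
          (\<forall>X\<in>tangent_space M p. \<forall>Y\<in>tangent_space M p. metric M p X Y = metric M p Y X) \<and>
          (\<exists>e. orthonormal_frame M p e)) \<and>
     (\<forall>c\<in>atlas M. \<forall>u v.
        smooth_in_chart c UNIV (\<lambda>p. metric M p (coord_vec M c p u) (coord_vec M c p v)))"

definition timelike :: "('m, 'z) spacetime_scheme \<Rightarrow> 'm \<Rightarrow> 'm tvec \<Rightarrow> bool" where
  "timelike M p X \<longleftrightarrow> X \<in> tangent_space M p \<and> metric M p X X > 0"

definition causal :: "('m, 'z) spacetime_scheme \<Rightarrow> 'm \<Rightarrow> 'm tvec \<Rightarrow> bool" where
  "causal M p X \<longleftrightarrow> X \<in> tangent_space M p \<and> X \<noteq> (\<lambda>c. 0) \<and> metric M p X X \<ge> 0"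

text \<open>Only meaningful for causal vectors.\<close>

definition future_directed :: "('m, 'z) spacetime_scheme \<Rightarrow> 'm \<Rightarrow> 'm tvec \<Rightarrow> bool" where
  "future_directed M p X \<longleftrightarrow> metric M p (time_or M p) X > 0"

definition time_orientation :: "('m, 'z) spacetime_scheme \<Rightarrow> bool" where
  "time_orientation M \<longleftrightarrow>
     smooth_vector_field_on M UNIV (time_or M) \<and> (\<forall>p. timelike M p (time_or M p))"

definition space_orientation :: "('m, 'z) spacetime_scheme \<Rightarrow> bool" where
  "space_orientation M \<longleftrightarrow>
     (\<forall>p. \<forall>X\<in>tangent_space M p. \<forall>Y\<in>tangent_space M p. \<forall>Z\<in>tangent_space M p.
        linear_at M p (space_or M p X Y) \<and>
        space_or M p Y X Z = - space_or M p X Y Z \<and>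
        space_or M p X Z Y = - space_or M p X Y Z \<and>
        (metric M p X X = -1 \<and> metric M p Y Y = -1 \<and> metric M p Z Z = -1 \<and>
         metric M p X Y = 0 \<and> metric M p X Z = 0 \<and> metric M p Y Z = 0
           \<longrightarrow> space_or M p X Y Z \<noteq> 0)) \<and>
     (\<forall>c\<in>atlas M. \<forall>u v w. smooth_in_chart c UNIV
        (\<lambda>p. space_or M p (coord_vec M c p u) (coord_vec M c p v) (coord_vec M c p w)))"

definition oriented_frames :: "('m, 'z) spacetime_scheme \<Rightarrow> 'm \<Rightarrow> 'm frame set" where
  "oriented_frames M p = {e. orthonormal_frame M p e \<and> future_directed M p (e 0) \<and>
     space_or M p (e 1) (e 2) (e 3) > 0}"

text \<open>Future directed causal curves, piecewise \<open>C\<^sup>1\<close>, parametrised by \<open>[a, b]\<close>.\<close>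

definition causal_C1_curve ::
  "('m, 'z) spacetime_scheme \<Rightarrow> (real \<Rightarrow> 'm::topological_space) \<Rightarrow> real \<Rightarrow> real \<Rightarrow> bool" where
  "causal_C1_curve M \<gamma> a b \<longleftrightarrow> a < b \<and> continuous_on {a..b} \<gamma> \<and>
     (\<exists>V. (\<forall>t\<in>{a..b}. causal M (\<gamma> t) (V t) \<and> future_directed M (\<gamma> t) (V t)) \<and>
       (\<forall>c\<in>atlas M.
          (\<forall>t\<in>{a..b}. \<gamma> t \<in> fst c \<longrightarrow>
             ((snd c \<circ> \<gamma>) has_vector_derivative V t c) (at t within {a..b})) \<and>
          continuous_on {t\<in>{a..b}. \<gamma> t \<in> fst c} (\<lambda>t. V t c)))"

inductive causal_curve ::
  "('m::topological_space, 'z) spacetime_scheme \<Rightarrow> (real \<Rightarrow> 'm) \<Rightarrow> real \<Rightarrow> real \<Rightarrow> bool"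
  for M \<gamma> where
  piece: "causal_C1_curve M \<gamma> a b \<Longrightarrow> causal_curve M \<gamma> a b"
| join: "causal_curve M \<gamma> a b \<Longrightarrow> causal_curve M \<gamma> b c \<Longrightarrow> causal_curve M \<gamma> a c"

definition causal_future :: "('m::topological_space, 'z) spacetime_scheme \<Rightarrow> 'm \<Rightarrow> 'm set" where
  "causal_future M p =
     insert p {q. \<exists>\<gamma> a b. causal_curve M \<gamma> a b \<and> \<gamma> a = p \<and> \<gamma> b = q}"

definition strongly_causal :: "('m::topological_space, 'z) spacetime_scheme \<Rightarrow> bool" where
  "strongly_causal M \<longleftrightarrow> (\<forall>p U. open U \<and> p \<in> U \<longrightarrow>
     (\<exists>V. open V \<and> p \<in> V \<and> V \<subseteq> U \<and>
       (\<forall>\<gamma> a b. causal_curve M \<gamma> a b \<and> \<gamma> a \<in> V \<and> \<gamma> b \<in> V \<longrightarrow> \<gamma> ` {a..b} \<subseteq> U)))"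

definition globally_hyperbolic :: "('m::topological_space, 'z) spacetime_scheme \<Rightarrow> bool" where
  "globally_hyperbolic M \<longleftrightarrow> strongly_causal M \<and>
     (\<forall>p q. compact (causal_future M p \<inter> {r. q \<in> causal_future M r}))"

definition spacetime_manifold ::
  "('m::{t2_space, second_countable_topology}, 'z) spacetime_scheme \<Rightarrow> bool" where
  "spacetime_manifold M \<longleftrightarrow> smooth_manifold M \<and> connected (UNIV :: 'm set) \<and>
     lorentz_metric M \<and> time_orientation M \<and> space_orientation M \<and> globally_hyperbolic M"

definition future_timelike_covector ::
  "('m, 'z) spacetime_scheme \<Rightarrow> 'm \<Rightarrow> ('m tvec \<Rightarrow> real) \<Rightarrow> bool" where
  "future_timelike_covector M p \<xi> \<longleftrightarrow>
     (\<exists>X. timelike M p X \<and> future_directed M p X \<and>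
          (\<forall>Y\<in>tangent_space M p. \<xi> Y = metric M p X Y))"

text \<open>
  Levi-Civita connection. In a chart, the Christoffel term \<open>w = \<Gamma>(u, v)\<close> is determined by
  \<open>2 g(w, z) = \<partial>\<^sub>u g(v, z) + \<partial>\<^sub>v g(u, z) - \<partial>\<^sub>z g(u, v)\<close> for constant component vectors \<open>u, v, z\<close>.
\<close>

definition metric_deriv ::
  "('m, 'z) spacetime_scheme \<Rightarrow> 'm chart \<Rightarrow> 'm \<Rightarrow> real^4 \<Rightarrow> real^4 \<Rightarrow> real^4 \<Rightarrow> real" where
  "metric_deriv M c p z u v = frechet_derivative
     ((\<lambda>q. metric M q (coord_vec M c q u) (coord_vec M c q v)) \<circ> chart_inv c) (at (snd c p)) z"

definition christoffel ::
  "('m, 'z) spacetime_scheme \<Rightarrow> 'm chart \<Rightarrow> 'm \<Rightarrow> real^4 \<Rightarrow> real^4 \<Rightarrow> real^4" where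
  "christoffel M c p u v = (THE w. \<forall>z.
     2 * metric M p (coord_vec M c p w) (coord_vec M c p z) =
       metric_deriv M c p u v z + metric_deriv M c p v u z - metric_deriv M c p z u v)"

definition levi_civita ::
  "('m, 'z) spacetime_scheme \<Rightarrow> 'm \<Rightarrow> 'm tvec \<Rightarrow> ('m \<Rightarrow> 'm tvec) \<Rightarrow> 'm tvec" where
  "levi_civita M p X Y = (\<lambda>c. if c \<in> charts_at M p
     then frechet_derivative ((\<lambda>q. Y q c) \<circ> chart_inv c) (at (snd c p)) (X c)
          + christoffel M c p (X c) (Y p c)
     else 0)"


section \<open>The covering \<open>\<lambda> : SL(2,\<complex>) \<rightarrow> SO\<^sup>+(1,3)\<close>\<close>

definition SL2C :: "(complex^2^2) set" where
  "SL2C = {S. det S = 1}"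

definition adjoint_mat :: "complex^2^2 \<Rightarrow> complex^2^2" where
  "adjoint_mat S = (\<chi> i j. cnj (S$j$i))"

definition pauli :: "4 \<Rightarrow> complex^2^2" where
  "pauli a =
     (if a = 1 then vector [vector [0, 1], vector [1, 0]]
      else if a = 2 then vector [vector [0, -\<i>], vector [\<i>, 0]]
      else if a = 3 then vector [vector [1, 0], vector [0, -1]]
      else mat 1)"

definition herm_mat :: "real^4 \<Rightarrow> complex^2^2" where
  "herm_mat x = (\<Sum>a\<in>UNIV. x$a *\<^sub>R pauli a)"

text \<open>
  The matrix \<open>\<lambda>(S)\<close> is given by \<open>herm_mat (\<lambda>(S) x) = S (herm_mat x) S\<^sup>*\<close>; the trace formula
  extracts its entries.
\<close>

definition lorentz_of :: "complex^2^2 \<Rightarrow> real^4^4" where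
  "lorentz_of S = (\<chi> a b. Re (trace (pauli a ** (S ** pauli b ** adjoint_mat S))) / 2)"

text \<open>
  Inverse of the differential of \<open>\<lambda>\<close> at the identity: the traceless \<open>B\<close> that corresponds to
  the element \<open>W\<close> of the Lie algebra of \<open>SO\<^sup>+(1,3)\<close>.
\<close>

definition sl2_lift :: "real^4^4 \<Rightarrow> complex^2^2" where
  "sl2_lift W = (THE B. trace B = 0 \<and>
     (\<forall>x. herm_mat (W *v x) = B ** herm_mat x + herm_mat x ** adjoint_mat B))"


section \<open>Spin structures and associated bundles\<close>

text \<open>
  The total space of the principal bundle is the type \<open>'s\<close>. Its smooth bundle structure is given
  by a family \<open>sections\<close> of local sections covering the base with smooth transition functions;
  a local section \<open>\<sigma>\<close> on \<open>U\<close> is the same thing as the local trivialisation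
  \<open>U \<times> SL(2,\<complex>) \<rightarrow> proj\<^sup>-\<^sup>1 U\<close>, \<open>(p, S) \<mapsto> \<sigma> p \<cdot> S\<close>. The map \<open>frame_map\<close> is the bundle map to the
  oriented, time-oriented frames.
\<close>

record ('m, 's) spin_spacetime = "'m spacetime" +
  proj :: "'s \<Rightarrow> 'm"
  act :: "'s \<Rightarrow> complex^2^2 \<Rightarrow> 's"
  sections :: "('m set \<times> ('m \<Rightarrow> 's)) set"
  frame_map :: "'s \<Rightarrow> 'm frame"

definition frame_act :: "'m frame \<Rightarrow> real^4^4 \<Rightarrow> 'm frame" where
  "frame_act e L = (\<lambda>b c. \<Sum>a\<in>UNIV. L$a$b *\<^sub>R e a c)"

definition spin_structure ::
  "('m::topological_space, 's, 'z) spin_spacetime_scheme \<Rightarrow> bool" where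
  "spin_structure M \<longleftrightarrow>
     (\<forall>s. act M s (mat 1) = s) \<and>
     (\<forall>s. \<forall>S\<in>SL2C. \<forall>S'\<in>SL2C. act M (act M s S) S' = act M s (S ** S')) \<and>
     (\<forall>s. \<forall>S\<in>SL2C. proj M (act M s S) = proj M s) \<and>
     (\<forall>s t. proj M s = proj M t \<longrightarrow> (\<exists>!S. S \<in> SL2C \<and> t = act M s S)) \<and>
     (\<forall>(U, \<sigma>)\<in>sections M. open U \<and> (\<forall>p\<in>U. proj M (\<sigma> p) = p)) \<and>
     (\<forall>p. \<exists>(U, \<sigma>)\<in>sections M. p \<in> U) \<and>
     (\<forall>(U, \<sigma>)\<in>sections M. \<forall>(U', \<sigma>')\<in>sections M. \<exists>S.
        (\<forall>p\<in>U \<inter> U'. S p \<in> SL2C \<and> \<sigma>' p = act M (\<sigma> p) (S p)) \<and>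
        (\<forall>i j. smooth_fun_on M (U \<inter> U') (\<lambda>p. S p $ i $ j))) \<and>
     (\<forall>s. frame_map M s \<in> oriented_frames M (proj M s)) \<and>
     (\<forall>s. \<forall>S\<in>SL2C. frame_map M (act M s S) = frame_act (frame_map M s) (lorentz_of S)) \<and>
     (\<forall>(U, \<sigma>)\<in>sections M. \<forall>a. smooth_vector_field_on M U (\<lambda>p. frame_map M (\<sigma> p) a))"

text \<open>
  A representation of \<open>SL(2,\<complex>)\<close> is a pair \<open>(V, \<rho>)\<close> of a space \<open>V\<close> of component functions and
  an action on it. A vector \<open>[s, v]\<close> of the associated bundle is the orbit of all
  \<open>(s \<cdot> S, \<rho>(S)\<^sup>-\<^sup>1 v)\<close>, which is the graph of an equivariant function on the fibre of the principal
  bundle; this function, extended by zero, represents it. Accordingly, sections are equivariant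
  functions on the principal bundle, and \<open>\<Phi> (\<sigma> p)\<close> are the components of \<open>\<Phi>\<close> at \<open>p\<close> with respect
  to the local section \<open>\<sigma>\<close>.
\<close>

type_synonym 'i rep = "('i \<Rightarrow> complex) set \<times> (complex^2^2 \<Rightarrow> ('i \<Rightarrow> complex) \<Rightarrow> 'i \<Rightarrow> complex)"

type_synonym ('s, 'i) bundle_fun = "'s \<Rightarrow> 'i \<Rightarrow> complex"

definition equivariant_over ::
  "('m, 's, 'z) spin_spacetime_scheme \<Rightarrow> 'i rep \<Rightarrow> 'm set \<Rightarrow> ('s, 'i) bundle_fun \<Rightarrow> bool" where
  "equivariant_over M E U \<Phi> \<longleftrightarrow> (\<forall>s. proj M s \<in> U \<longrightarrow> \<Phi> s \<in> fst E \<and>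
     (\<forall>S\<in>SL2C. \<Phi> (act M s S) = snd E (matrix_inv S) (\<Phi> s)))"

definition fibre ::
  "('m, 's, 'z) spin_spacetime_scheme \<Rightarrow> 'i rep \<Rightarrow> 'm \<Rightarrow> ('s, 'i) bundle_fun set" where
  "fibre M E p = {u. equivariant_over M E {p} u \<and> (\<forall>s. proj M s \<noteq> p \<longrightarrow> u s = (\<lambda>i. 0))}"

definition restrict_fibre ::
  "('m, 's, 'z) spin_spacetime_scheme \<Rightarrow> 'm \<Rightarrow> ('s, 'i) bundle_fun \<Rightarrow> ('s, 'i) bundle_fun" where
  "restrict_fibre M p \<Phi> = (\<lambda>s. if proj M s = p then \<Phi> s else (\<lambda>i. 0))"

definition smooth_section_on ::
  "('m, 's, 'z) spin_spacetime_scheme \<Rightarrow> 'i rep \<Rightarrow> 'm set \<Rightarrow> ('s, 'i) bundle_fun \<Rightarrow> bool" where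
  "smooth_section_on M E U \<Phi> \<longleftrightarrow> equivariant_over M E U \<Phi> \<and>
     (\<forall>(W, \<sigma>)\<in>sections M. \<forall>i. smooth_fun_on M (U \<inter> W) (\<lambda>p. \<Phi> (\<sigma> p) i))"

definition fun_times_section ::
  "('m, 's, 'z) spin_spacetime_scheme \<Rightarrow> ('m \<Rightarrow> real) \<Rightarrow> ('s, 'i) bundle_fun \<Rightarrow> ('s, 'i) bundle_fun" where
  "fun_times_section M f \<Phi> = (\<lambda>s i. complex_of_real (f (proj M s)) * \<Phi> s i)"

text \<open>
  Covariant derivative \<open>\<nabla>\<^sub>X \<Phi>\<close>, \<open>X\<close> a tangent vector at the base point of \<open>s\<close>. In a local section
  \<open>\<sigma>\<close> with frame \<open>e = frame_map \<circ> \<sigma>\<close>, let \<open>\<omega>\<close> be the Levi-Civita connection matrix,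
  \<open>\<nabla>\<^sub>X e\<^sub>b = e\<^sub>a \<omega>\<^sup>a\<^sub>b\<close>. Then \<open>\<nabla>\<^sub>X \<Phi>\<close> has the components
  \<open>X(\<Phi> \<circ> \<sigma>) + d\<rho>(sl2_lift \<omega>) (\<Phi> \<circ> \<sigma>)\<close> at \<open>\<sigma> p\<close>, and its value at \<open>s = \<sigma> p \<cdot> S\<close> follows by
  equivariance. The result does not depend on \<open>\<sigma>\<close>.
\<close>

definition connection_matrix ::
  "('m, 'z) spacetime_scheme \<Rightarrow> ('m \<Rightarrow> 'm frame) \<Rightarrow> 'm \<Rightarrow> 'm tvec \<Rightarrow> real^4^4" where
  "connection_matrix M e p X =
     (\<chi> a b. eta a a * metric M p (e p a) (levi_civita M p X (\<lambda>q. e q b)))"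

definition cov_deriv ::
  "('m, 's, 'z) spin_spacetime_scheme \<Rightarrow> 'i rep \<Rightarrow> (complex^2^2 \<Rightarrow> ('i \<Rightarrow> complex) \<Rightarrow> 'i \<Rightarrow> complex)
     \<Rightarrow> 'm tvec \<Rightarrow> ('s, 'i) bundle_fun \<Rightarrow> 's \<Rightarrow> 'i \<Rightarrow> complex" where
  "cov_deriv M E d\<rho> X \<Phi> s =
     (let p = proj M s;
          \<sigma> = snd (SOME w. w \<in> sections M \<and> p \<in> fst w);
          S = (THE S. S \<in> SL2C \<and> s = act M (\<sigma> p) S);
          B = sl2_lift (connection_matrix M (\<lambda>q. frame_map M (\<sigma> q)) p X)
      in snd E (matrix_inv S)
           (\<lambda>i. dir_deriv M p X (\<lambda>q. \<Phi> (\<sigma> q) i) + d\<rho> B (\<Phi> (\<sigma> p)) i))"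


section \<open>Principal symbols and operators of indefinite type\<close>

text \<open>
  Principal symbol of a first order linear differential operator, as an endomorphism of the fibre
  at \<open>p\<close>: \<open>s\<^sub>P(\<xi>) \<Phi>(p) = (P (f \<Phi>) - f P \<Phi>)(p)\<close> if \<open>df\<^sub>p = \<xi>\<close>. Differential operators are
  local and hence act on local sections.
\<close>

definition principal_symbol ::
  "('m::topological_space, 's, 'z) spin_spacetime_scheme \<Rightarrow> 'i rep
     \<Rightarrow> (('s, 'i) bundle_fun \<Rightarrow> ('s, 'i) bundle_fun)
     \<Rightarrow> 'm \<Rightarrow> ('m tvec \<Rightarrow> real) \<Rightarrow> ('s, 'i) bundle_fun \<Rightarrow> ('s, 'i) bundle_fun" where
  "principal_symbol M E P p \<xi> v = (THE w. \<forall>U f \<Phi>.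
     open U \<and> p \<in> U \<and> smooth_fun_on M U f \<and> smooth_section_on M E U \<Phi> \<and>
     (\<forall>X\<in>tangent_space M p. dir_deriv M p X f = \<xi> X) \<and> restrict_fibre M p \<Phi> = v
     \<longrightarrow> w = restrict_fibre M p
           (\<lambda>s i. P (fun_times_section M f \<Phi>) s i - fun_times_section M f (P \<Phi>) s i))"

definition hermitian_on ::
  "('s, 'i) bundle_fun set \<Rightarrow> (('s, 'i) bundle_fun \<Rightarrow> ('s, 'i) bundle_fun \<Rightarrow> complex) \<Rightarrow> bool" where
  "hermitian_on F h \<longleftrightarrow>
     (\<forall>u\<in>F. \<forall>v\<in>F. \<forall>w\<in>F. \<forall>a b. h u (\<lambda>s i. a * v s i + b * w s i) = a * h u v + b * h u w) \<and>
     (\<forall>u\<in>F. \<forall>v\<in>F. h v u = cnj (h u v))"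

definition indefinite_on ::
  "('s, 'i) bundle_fun set \<Rightarrow> (('s, 'i) bundle_fun \<Rightarrow> ('s, 'i) bundle_fun \<Rightarrow> complex) \<Rightarrow> bool" where
  "indefinite_on F h \<longleftrightarrow>
     (\<exists>v\<in>F. h v v \<in> \<real> \<and> Re (h v v) > 0) \<and> (\<exists>v\<in>F. h v v \<in> \<real> \<and> Re (h v v) < 0)"

definition symbol_form ::
  "('m::topological_space, 's, 'z) spin_spacetime_scheme \<Rightarrow> 'i rep
     \<Rightarrow> (('s, 'i) bundle_fun \<Rightarrow> ('s, 'i) bundle_fun)
     \<Rightarrow> ('m \<Rightarrow> ('s, 'i) bundle_fun \<Rightarrow> ('s, 'i) bundle_fun \<Rightarrow> complex)
     \<Rightarrow> ('m \<Rightarrow> 'm tvec \<Rightarrow> real)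
     \<Rightarrow> 'm \<Rightarrow> ('s, 'i) bundle_fun \<Rightarrow> ('s, 'i) bundle_fun \<Rightarrow> complex" where
  "symbol_form M E P ip \<xi> p u v = ip p u (principal_symbol M E P p (\<xi> p) v)"

definition indefinite_type ::
  "('m::topological_space, 's, 'z) spin_spacetime_scheme \<Rightarrow> 'i rep
     \<Rightarrow> (('s, 'i) bundle_fun \<Rightarrow> ('s, 'i) bundle_fun)
     \<Rightarrow> ('m \<Rightarrow> ('s, 'i) bundle_fun \<Rightarrow> ('s, 'i) bundle_fun \<Rightarrow> complex) \<Rightarrow> bool" where
  "indefinite_type M E P ip \<longleftrightarrow>
     (\<forall>\<xi>. smooth_covector_field M \<xi> \<and> (\<forall>p. future_timelike_covector M p (\<xi> p)) \<longrightarrow>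
        (\<forall>p. indefinite_on (fibre M E p) (symbol_form M E P ip \<xi> p)))"


section \<open>The higher spin bundle \<open>\<M>\<^sup>k\<^sup>,\<^sup>k\<close> and the operator \<open>\<T>\<^sup>k\<^sup>,\<^sup>k\<close>\<close>

text \<open>
  Component indices are triples \<open>(i, As, Xs)\<close>: a Dirac index \<open>i :: 2 + 2\<close> (\<open>Inl\<close> an upper undotted,
  \<open>Inr\<close> a lower dotted index), \<open>k\<close> upper undotted indices \<open>As\<close> and \<open>k\<close> lower dotted indices \<open>Xs\<close>.
\<close>

type_synonym spin_index = "(2 + 2) \<times> 2 list \<times> 2 list"

definition multi_index :: "nat \<Rightarrow> 2 list set" where
  "multi_index k = {As. length As = k}"

definition higher_spin_space :: "nat \<Rightarrow> (spin_index \<Rightarrow> complex) set" where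
  "higher_spin_space k = {\<phi>.
     (\<forall>i As Xs. As \<notin> multi_index k \<or> Xs \<notin> multi_index k \<longrightarrow> \<phi> (i, As, Xs) = 0) \<and>
     (\<forall>i As Xs As' Xs'. mset As = mset As' \<and> mset Xs = mset Xs' \<longrightarrow>
        \<phi> (i, As, Xs) = \<phi> (i, As', Xs'))}"

text \<open>The representation on \<open>\<Delta>\<^sub>-\<^sup>*\<close> and its differential.\<close>

definition dual_conj :: "complex^2^2 \<Rightarrow> complex^2^2" where
  "dual_conj S = transpose (\<chi> i j. cnj (matrix_inv S $ i $ j))"

definition dual_conj_deriv :: "complex^2^2 \<Rightarrow> complex^2^2" where
  "dual_conj_deriv B = - transpose (\<chi> i j. cnj (B$i$j))"

definition block_mat ::
  "complex^2^2 \<Rightarrow> complex^2^2 \<Rightarrow> complex^2^2 \<Rightarrow> complex^2^2 \<Rightarrow> complex^(2+2)^(2+2)" where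
  "block_mat P Q R S = (\<chi> i j. case i of
       Inl a \<Rightarrow> (case j of Inl b \<Rightarrow> P$a$b | Inr b \<Rightarrow> Q$a$b)
     | Inr a \<Rightarrow> (case j of Inl b \<Rightarrow> R$a$b | Inr b \<Rightarrow> S$a$b))"

definition higher_spin_act ::
  "nat \<Rightarrow> complex^2^2 \<Rightarrow> (spin_index \<Rightarrow> complex) \<Rightarrow> spin_index \<Rightarrow> complex" where
  "higher_spin_act k S \<phi> = (\<lambda>(i, As, Xs).
     if As \<in> multi_index k \<and> Xs \<in> multi_index k
     then \<Sum>j\<in>UNIV. \<Sum>Bs\<in>multi_index k. \<Sum>Ys\<in>multi_index k.
            block_mat S 0 0 (dual_conj S) $ i $ j *
            (\<Prod>n<k. S $ (As!n) $ (Bs!n)) * (\<Prod>n<k. dual_conj S $ (Xs!n) $ (Ys!n)) *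
            \<phi> (j, Bs, Ys)
     else 0)"

text \<open>The differential of \<open>higher_spin_act\<close> at the identity, by the Leibniz rule.\<close>

definition higher_spin_act_deriv ::
  "nat \<Rightarrow> complex^2^2 \<Rightarrow> (spin_index \<Rightarrow> complex) \<Rightarrow> spin_index \<Rightarrow> complex" where
  "higher_spin_act_deriv k B \<phi> = (\<lambda>(i, As, Xs).
     if As \<in> multi_index k \<and> Xs \<in> multi_index k
     then (\<Sum>j\<in>UNIV. block_mat B 0 0 (dual_conj_deriv B) $ i $ j * \<phi> (j, As, Xs))
        + (\<Sum>n<k. \<Sum>C\<in>UNIV. B $ (As!n) $ C * \<phi> (i, As[n := C], Xs))
        + (\<Sum>n<k. \<Sum>Y\<in>UNIV. dual_conj_deriv B $ (Xs!n) $ Y * \<phi> (i, As, Xs[n := Y]))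
     else 0)"

definition higher_spin :: "nat \<Rightarrow> spin_index rep" where
  "higher_spin k = (higher_spin_space k, higher_spin_act k)"

definition gamma :: "4 \<Rightarrow> complex^(2+2)^(2+2)" where
  "gamma a = (if a = 0 then (1 / sqrt 2) *\<^sub>R block_mat 0 (mat 1) (mat 1) 0
     else (1 / sqrt 2) *\<^sub>R block_mat 0 (pauli a) (- pauli a) 0)"

definition gamma_up :: "4 \<Rightarrow> complex^(2+2)^(2+2)" where
  "gamma_up a = (\<Sum>b\<in>UNIV. eta a b *\<^sub>R gamma b)"

text \<open>The field \<open>\<gamma>\<^sup>a\<close> has constant components in every local section.\<close>

definition higher_spin_op ::
  "('m, 's, 'z) spin_spacetime_scheme \<Rightarrow> nat
     \<Rightarrow> ('s, spin_index) bundle_fun \<Rightarrow> ('s, spin_index) bundle_fun" where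
  "higher_spin_op M k \<Phi> = (\<lambda>s (i, As, Xs). \<Sum>a\<in>UNIV. \<Sum>j\<in>UNIV. gamma_up a $ i $ j *
     cov_deriv M (higher_spin k) (higher_spin_act_deriv k) (frame_map M s a) \<Phi> s (j, As, Xs))"

text \<open>
  Complex conjugation exchanges dotted and undotted indices; hence the two multi-indices of the
  conjugated argument are swapped.
\<close>

definition component_product ::
  "nat \<Rightarrow> (spin_index \<Rightarrow> complex) \<Rightarrow> (spin_index \<Rightarrow> complex) \<Rightarrow> complex" where
  "component_product k \<phi> \<psi> =
     (\<Sum>A\<in>UNIV. \<Sum>As\<in>multi_index k. \<Sum>Xs\<in>multi_index k.
        cnj (\<phi> (Inr A, Xs, As)) * \<psi> (Inl A, As, Xs))
   + (\<Sum>X\<in>UNIV. \<Sum>As\<in>multi_index k. \<Sum>Xs\<in>multi_index k.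
        cnj (\<phi> (Inl X, Xs, As)) * \<psi> (Inr X, As, Xs))"

text \<open>By invariance, all points of the principal bundle over \<open>p\<close> give the same value.\<close>

definition higher_spin_product ::
  "('m, 's, 'z) spin_spacetime_scheme \<Rightarrow> nat
     \<Rightarrow> 'm \<Rightarrow> ('s, spin_index) bundle_fun \<Rightarrow> ('s, spin_index) bundle_fun \<Rightarrow> complex" where
  "higher_spin_product M k p u v =
     (let s = (SOME s. proj M s = p) in component_product k (u s) (v s))"

end

theory Submission
  imports Defs "HOL-Combinatorics.Permutations"
begin

text \<open>
  By the Leibniz rule, and because every covector at \<open>p\<close> is some \<open>df\<^sub>p\<close> and every fibre vector extends
  to a local section, the principal symbol at \<open>\<xi>\<close> is multiplication by \<open>\<xi>\<^sub>a \<gamma>\<^sup>a\<close>. In a spin frame this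
  matrix is off-diagonal with Hermitian blocks \<open>(\<xi>\<^sub>0 \<mp> \<xi> \<cdot> \<sigma>) / \<surd>2\<close>. The Hermitian product pairs the
  component with multi-indices \<open>(As, Xs)\<close> of one argument with the component \<open>(Xs, As)\<close> of the other. Hence on
  spinors \<open>(0, b \<otimes> t)\<close>, where \<open>b\<close> is the first basis vector, the form is a nonzero multiple of
  \<open>\<Sum> cnj t(Xs, As) t(As, Xs)\<close>, and \<open>t = u \<otimes> d \<plusminus> d \<otimes> u\<close> with \<open>u = 1\<dots>1\<close>, \<open>d = 2\<dots>2\<close> makes this \<open>\<plusminus>2\<close>.
\<close>

subsection \<open>Smooth functions and tangent vectors in charts\<close>

lemma Ck_on_mono: "Ck_on n f S \<Longrightarrow> T \<subseteq> S \<Longrightarrow> Ck_on n f T"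
proof (induction n arbitrary: f)
  case 0
  then show ?case by (auto intro: continuous_on_subset)
next
  case (Suc n)
  then show ?case by (auto simp: subset_iff)
qed

text \<open>\<open>Ck_on\<close> uses the full derivative \<open>at x\<close>, which also sees
  values off \<open>S\<close>. Openness turns agreement on \<open>S\<close> into agreement near each
  point, so the derivatives agree on \<open>S\<close> as well and the induction can continue with
  them.\<close>

lemma Ck_on_cong:
  assumes "open S" and "\<And>x. x \<in> S \<Longrightarrow> f x = g x" and "Ck_on n f S"
  shows "Ck_on n g S"
  using assms(2,3)
proof (induction n arbitrary: f g)
  case 0
  then show ?case by (auto cong: continuous_on_cong)
next
  case (Suc n)
  have D: "(g has_derivative frechet_derivative f (at x)) (at x)" if "x \<in> S" for x
  proof (rule has_derivative_transform_within_open[OF _ assms(1) that Suc.prems(1)])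
    show "(f has_derivative frechet_derivative f (at x)) (at x)"
      using Suc.prems(2) that by (simp add: frechet_derivative_works)
  qed
  then have "frechet_derivative f (at x) = frechet_derivative g (at x)" if "x \<in> S" for x
    using that frechet_derivative_at by blast
  then show ?case
    using Suc.IH[of "\<lambda>x. frechet_derivative f (at x) v" "\<lambda>x. frechet_derivative g (at x) v" for v]
      Suc.prems D by (simp add: frechet_derivative_works)
qed

lemma Ck_on_SucD: "Ck_on (Suc n) f S \<Longrightarrow> Ck_on n f S"
proof (induction n arbitrary: f)
  case 0
  then show ?case
    by (auto intro!: continuous_at_imp_continuous_on differentiable_imp_continuous_within)
next
  case (Suc n)
  then show ?case by (metis Ck_on.simps(2))
qed

lemma Ck_on_const: "Ck_on n (\<lambda>x. c) S"
proof (induction n arbitrary: c)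
  case (Suc n)
  then show ?case by (simp add: frechet_derivative_const)
qed simp

lemma Ck_on_add:
  assumes "open S"
  shows "Ck_on n f S \<Longrightarrow> Ck_on n g S \<Longrightarrow> Ck_on n (\<lambda>x. f x + g x) S"
proof (induction n arbitrary: f g)
  case 0
  then show ?case by (auto intro: continuous_on_add)
next
  case (Suc n)
  have "Ck_on n (\<lambda>x. frechet_derivative (\<lambda>x. f x + g x) (at x) v) S" for v
  proof (rule Ck_on_cong[OF assms])
    show "Ck_on n (\<lambda>x. frechet_derivative f (at x) v + frechet_derivative g (at x) v) S"
      using Suc by auto
    show "frechet_derivative f (at x) v + frechet_derivative g (at x) v
        = frechet_derivative (\<lambda>x. f x + g x) (at x) v" if "x \<in> S" for x
      using Suc.prems that
      by (subst frechet_derivative_at[OF has_derivative_add, symmetric])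
        (auto simp: frechet_derivative_works)
  qed
  then show ?case using Suc.prems by simp
qed

lemma Ck_on_mult:
  fixes f g :: "'a::real_normed_vector \<Rightarrow> 'b::real_normed_algebra"
  assumes "open S"
  shows "Ck_on n f S \<Longrightarrow> Ck_on n g S \<Longrightarrow> Ck_on n (\<lambda>x. f x * g x) S"
proof (induction n arbitrary: f g)
  case 0
  then show ?case by (auto intro: continuous_on_mult)
next
  case (Suc n)
  have "Ck_on n (\<lambda>x. frechet_derivative (\<lambda>x. f x * g x) (at x) v) S" for v
  proof (rule Ck_on_cong[OF assms])
    \<comment> \<open>The Leibniz rule leaves one factor undifferentiated in each term. That factor
      is known at order \<open>Suc n\<close> and has to be lowered to order \<open>n\<close> for the
      induction hypothesis.\<close>
    show "Ck_on n (\<lambda>x. f x * frechet_derivative g (at x) v + frechet_derivative f (at x) v * g x) S"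
      using Suc Ck_on_SucD[OF Suc.prems(1)] Ck_on_SucD[OF Suc.prems(2)]
      by (auto intro!: Ck_on_add[OF assms])
    show "f x * frechet_derivative g (at x) v + frechet_derivative f (at x) v * g x
        = frechet_derivative (\<lambda>x. f x * g x) (at x) v" if "x \<in> S" for x
      using Suc.prems that
      by (subst frechet_derivative_at[OF has_derivative_mult, symmetric])
        (auto simp: frechet_derivative_works)
  qed
  then show ?case using Suc.prems by (simp add: differentiable_mult)
qed

text \<open>Serves three maps later on: negation, complex conjugation (linear over the reals only)
  and linear functionals of chart coordinates.\<close>

lemma Ck_on_bounded_linear:
  assumes "open S" and L: "bounded_linear L"
  shows "Ck_on n f S \<Longrightarrow> Ck_on n (\<lambda>x. L (f x)) S"
proof (induction n arbitrary: f)
  case 0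
  then show ?case
    by (auto intro: continuous_on_compose2[OF linear_continuous_on[OF L, of UNIV]])
next
  case (Suc n)
  have D: "((\<lambda>x. L (f x)) has_derivative (\<lambda>v. L (frechet_derivative f (at x) v))) (at x)"
    if "x \<in> S" for x
    using Suc.prems that
    by (auto intro!: bounded_linear.has_derivative[OF L] simp: frechet_derivative_works[symmetric])
  have "Ck_on n (\<lambda>x. frechet_derivative (\<lambda>x. L (f x)) (at x) v) S" for v
  proof (rule Ck_on_cong[OF assms(1)])
    show "Ck_on n (\<lambda>x. L (frechet_derivative f (at x) v)) S" using Suc by auto
  qed (simp flip: frechet_derivative_at[OF D])
  then show ?case using D by (auto simp: differentiable_def)
qed

section \<open>Smooth functions on the manifold, read in charts\<close>

lemma chart_inv_left:
  assumes "smooth_manifold M" and "c \<in> atlas M" and "q \<in> fst c"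
  shows "chart_inv c (snd c q) = q"
  using assms by (auto simp: smooth_manifold_def homeomorphism_def)

lemma open_chart_image:
  assumes "smooth_manifold M" and "c \<in> atlas M" and "open U"
  shows "open (snd c ` (U \<inter> fst c))"
proof -
  have c: "open (fst c)" "open (snd c ` fst c)"
    "homeomorphism (fst c) (snd c ` fst c) (snd c) (chart_inv c)"
    using assms(1,2) by (auto simp: smooth_manifold_def)
  then have "openin (top_of_set (fst c)) (U \<inter> fst c)"
    using assms(3) by (auto simp: openin_open_eq)
  then have "openin (top_of_set (snd c ` fst c)) (snd c ` (U \<inter> fst c))"
    using c(3) homeomorphism_imp_open_map by blast
  then show ?thesis using c(2) openin_open_trans by blast
qed

context
  fixes M :: "('m::topological_space, 'z) spacetime_scheme" and U :: "'m set"
  assumes M: "smooth_manifold M" and U: "open U"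
begin

lemma smooth_fun_on_cong:
  assumes "\<And>p. p \<in> U \<Longrightarrow> f p = g p" and "smooth_fun_on M U f"
  shows "smooth_fun_on M U g"
  unfolding smooth_fun_on_def smooth_in_chart_def smooth_on_def
proof (intro ballI allI)
  fix c n assume c: "c \<in> atlas M"
  show "Ck_on n (g \<circ> chart_inv c) (snd c ` (U \<inter> fst c))"
  proof (rule Ck_on_cong[OF open_chart_image[OF M c U]])
    show "Ck_on n (f \<circ> chart_inv c) (snd c ` (U \<inter> fst c))"
      using assms(2) c by (auto simp: smooth_fun_on_def smooth_in_chart_def smooth_on_def)
  qed (use chart_inv_left[OF M c] assms(1) in auto)
qed

lemma smooth_fun_on_const: "smooth_fun_on M U (\<lambda>p. a)"
  by (simp add: smooth_fun_on_def smooth_in_chart_def smooth_on_def comp_def Ck_on_const)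

lemma smooth_fun_on_add:
  "smooth_fun_on M U f \<Longrightarrow> smooth_fun_on M U g \<Longrightarrow> smooth_fun_on M U (\<lambda>p. f p + g p)"
  by (simp add: smooth_fun_on_def smooth_in_chart_def smooth_on_def comp_def Ck_on_add
      open_chart_image[OF M _ U])

lemma smooth_fun_on_mult:
  fixes f g :: "'m \<Rightarrow> 'b::real_normed_algebra"
  shows "smooth_fun_on M U f \<Longrightarrow> smooth_fun_on M U g \<Longrightarrow> smooth_fun_on M U (\<lambda>p. f p * g p)"
  by (simp add: smooth_fun_on_def smooth_in_chart_def smooth_on_def comp_def Ck_on_mult
      open_chart_image[OF M _ U])

lemma smooth_fun_on_bounded_linear:
  "bounded_linear L \<Longrightarrow> smooth_fun_on M U f \<Longrightarrow> smooth_fun_on M U (\<lambda>p. L (f p))"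
  unfolding smooth_fun_on_def smooth_in_chart_def smooth_on_def comp_def
  using Ck_on_bounded_linear[OF open_chart_image[OF M _ U]] by blast

lemma smooth_fun_on_sum:
  "(\<And>i. i \<in> I \<Longrightarrow> smooth_fun_on M U (f i)) \<Longrightarrow> smooth_fun_on M U (\<lambda>p. \<Sum>i\<in>I. f i p)"
  by (induction I rule: infinite_finite_induct) (auto intro: smooth_fun_on_const smooth_fun_on_add)

lemma smooth_fun_on_prod:
  fixes f :: "'i \<Rightarrow> 'm \<Rightarrow> 'b::{real_normed_algebra, comm_ring_1}"
  shows "(\<And>i. i \<in> I \<Longrightarrow> smooth_fun_on M U (f i)) \<Longrightarrow> smooth_fun_on M U (\<lambda>p. \<Prod>i\<in>I. f i p)"
  by (induction I rule: infinite_finite_induct) (auto intro: smooth_fun_on_const smooth_fun_on_mult)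

end

lemma smooth_fun_on_mono: "smooth_fun_on M U f \<Longrightarrow> V \<subseteq> U \<Longrightarrow> smooth_fun_on M V f"
  unfolding smooth_fun_on_def smooth_in_chart_def smooth_on_def
  by (meson Ck_on_mono Int_mono image_mono order_refl)

lemma smooth_fun_on_differentiable:
  assumes "smooth_fun_on M U f" and "p \<in> U" and "c \<in> charts_at M p"
  shows "(f \<circ> chart_inv c) differentiable (at (snd c p))"
proof -
  have "Ck_on (Suc 0) (f \<circ> chart_inv c) (snd c ` (U \<inter> fst c))"
    using assms unfolding smooth_fun_on_def smooth_in_chart_def smooth_on_def charts_at_def by blast
  then show ?thesis using assms by (auto simp: charts_at_def)
qed

lemma frechet_derivative_chart_cong:
  assumes M: "smooth_manifold M" and c: "c \<in> charts_at M p" and U: "open U" "p \<in> U"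
    and eq: "\<And>q. q \<in> U \<Longrightarrow> f q = g q"
    and f: "(f \<circ> chart_inv c) differentiable (at (snd c p))"
  shows "(g \<circ> chart_inv c) differentiable (at (snd c p))"
    and "frechet_derivative (g \<circ> chart_inv c) (at (snd c p))
      = frechet_derivative (f \<circ> chart_inv c) (at (snd c p))"
proof -
  have ca: "c \<in> atlas M" "p \<in> fst c" using c by (auto simp: charts_at_def)
  have D: "(g \<circ> chart_inv c has_derivative frechet_derivative (f \<circ> chart_inv c) (at (snd c p)))
      (at (snd c p))"
  proof (rule has_derivative_transform_within_open[OF _ open_chart_image[OF M ca(1) U(1)]])
    show "(f \<circ> chart_inv c has_derivative frechet_derivative (f \<circ> chart_inv c) (at (snd c p)))
      (at (snd c p))"
      using f by (simp only: frechet_derivative_works[symmetric])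
  qed (use ca U(2) eq chart_inv_left[OF M ca(1)] in auto)
  show "(g \<circ> chart_inv c) differentiable (at (snd c p))"
    "frechet_derivative (g \<circ> chart_inv c) (at (snd c p))
      = frechet_derivative (f \<circ> chart_inv c) (at (snd c p))"
    using differentiableI[OF D] frechet_derivative_at[OF D] by simp_all
qed

section \<open>Tangent vectors and linear forms on them\<close>

lemma chart_transition_differentiable:
  assumes "smooth_manifold M" and "c \<in> charts_at M p" and "c' \<in> charts_at M p"
  shows "(snd c' \<circ> chart_inv c) differentiable (at (snd c p))"
proof -
  have "Ck_on (Suc 0) (snd c' \<circ> chart_inv c) (snd c ` (fst c' \<inter> fst c))"
    using assms unfolding smooth_manifold_def smooth_in_chart_def smooth_on_def charts_at_def
    by blast
  then show ?thesis using assms by (auto simp: charts_at_def)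
qed

lemma coord_vec_linear:
  assumes "smooth_manifold M" and "c \<in> charts_at M p"
  shows "coord_vec M c p (a *\<^sub>R u + b *\<^sub>R v)
    = (\<lambda>c'. a *\<^sub>R coord_vec M c p u c' + b *\<^sub>R coord_vec M c p v c')"
proof
  fix c'
  show "coord_vec M c p (a *\<^sub>R u + b *\<^sub>R v) c'
    = a *\<^sub>R coord_vec M c p u c' + b *\<^sub>R coord_vec M c p v c'"
  proof (cases "c' \<in> charts_at M p")
    case True
    then have "linear (frechet_derivative (snd c' \<circ> chart_inv c) (at (snd c p)))"
      using chart_transition_differentiable[OF assms] linear_frechet_derivative by blast
    then show ?thesis using True by (simp add: coord_vec_def linear_add linear_scale)
  qed (simp add: coord_vec_def)
qed

lemma tangent_space_combination:
  assumes "smooth_manifold M" and "X \<in> tangent_space M p" and "Y \<in> tangent_space M p"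
  shows "(\<lambda>c. a *\<^sub>R X c + b *\<^sub>R Y c) \<in> tangent_space M p"
proof -
  have "(\<lambda>c. a *\<^sub>R X c + b *\<^sub>R Y c) = coord_vec M c p (a *\<^sub>R X c + b *\<^sub>R Y c)"
    if c: "c \<in> charts_at M p" for c
  proof -
    have "X = coord_vec M c p (X c)" "Y = coord_vec M c p (Y c)"
      using assms c by (auto simp: tangent_space_def)
    then show ?thesis using coord_vec_linear[OF assms(1) c, of a "X c" b "Y c"] by simp
  qed
  then show ?thesis by (simp add: tangent_space_def)
qed

text \<open>Membership demands that the components in any two charts \<open>c'\<close> and
  \<open>c''\<close> be related by the transition map between them. This is the chain rule for the
  transitions from \<open>c\<close> to \<open>c'\<close> and from \<open>c'\<close> to
  \<open>c''\<close>.\<close>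

lemma coord_vec_in_tangent_space:
  assumes M: "smooth_manifold M" and c: "c \<in> charts_at M p"
  shows "coord_vec M c p v \<in> tangent_space M p"
proof -
  have "coord_vec M c p v c'' = coord_vec M c' p (coord_vec M c p v c') c''"
    if c': "c' \<in> charts_at M p" for c' c''
  proof (cases "c'' \<in> charts_at M p")
    case True
    let ?f = "snd c' \<circ> chart_inv c" and ?g = "snd c'' \<circ> chart_inv c'"
    have p: "chart_inv c (snd c p) = p" "c \<in> atlas M" "p \<in> fst c" "c' \<in> atlas M"
      "p \<in> fst c'" "open (fst c')"
      using c c' M chart_inv_left[OF M] by (auto simp: charts_at_def smooth_manifold_def)
    have f: "(?f has_derivative frechet_derivative ?f (at (snd c p))) (at (snd c p))"
      and g: "(?g has_derivative frechet_derivative ?g (at (snd c' p))) (at (?f (snd c p)))"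
      using chart_transition_differentiable[OF M c c'] chart_transition_differentiable[OF M c' True]
      by (simp_all only: frechet_derivative_works comp_apply p(1))
    have "(?g \<circ> ?f has_derivative
        frechet_derivative ?g (at (snd c' p)) \<circ> frechet_derivative ?f (at (snd c p))) (at (snd c p))"
      using diff_chain_at[OF f g] .
    \<comment> \<open>The composite of the two transitions equals the direct one only over the
      overlap of \<open>c\<close> and \<open>c'\<close>, an open set around the point, which
      suffices for equal derivatives.\<close>
    then have "(snd c'' \<circ> chart_inv c has_derivative
        frechet_derivative ?g (at (snd c' p)) \<circ> frechet_derivative ?f (at (snd c p))) (at (snd c p))"
      by (rule has_derivative_transform_within_open[OF _ open_chart_image[OF M p(2) p(6)]])
        (use p(3,5) chart_inv_left[OF M p(2)] chart_inv_left[OF M p(4)] in auto)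
    then have "frechet_derivative (snd c'' \<circ> chart_inv c) (at (snd c p))
      = frechet_derivative ?g (at (snd c' p)) \<circ> frechet_derivative ?f (at (snd c p))"
      by (rule frechet_derivative_at[symmetric])
    then show ?thesis using c' True by (simp add: coord_vec_def del: o_apply) (simp only: o_apply)
  qed (simp add: coord_vec_def)
  then show ?thesis unfolding tangent_space_def by (intro CollectI ballI ext)
qed

lemma linear_at_zero:
  assumes "linear_at M p f" and "X \<in> tangent_space M p"
  shows "f (\<lambda>c. 0) = 0"
  using assms(1)[unfolded linear_at_def, rule_format, OF assms(2,2), of 0 0] by simp

text \<open>\<open>linear_at\<close> speaks about tangent vectors only, so each induction step needs
  to know that the partial sum is one. Hence membership and linearity are proved together.\<close>

lemma linear_at_sum:
  fixes x :: "'i \<Rightarrow> real"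
  assumes M: "smooth_manifold M" and f: "linear_at M p f" and "finite A"
    and e: "\<And>a. e a \<in> tangent_space M p"
  shows "(\<lambda>c. \<Sum>a\<in>A. x a *\<^sub>R e a c) \<in> tangent_space M p
    \<and> f (\<lambda>c. \<Sum>a\<in>A. x a *\<^sub>R e a c) = (\<Sum>a\<in>A. x a * f (e a))"
  using \<open>finite A\<close>
proof induction
  case empty
  have "(\<lambda>c. 0) \<in> tangent_space M p"
    using tangent_space_combination[OF M e e, of 0 _ 0] by simp
  then show ?case using linear_at_zero[OF f] by simp
next
  case (insert a A)
  let ?Y = "\<lambda>c. \<Sum>a\<in>A. x a *\<^sub>R e a c"
  have "f (\<lambda>c. x a *\<^sub>R e a c + 1 *\<^sub>R ?Y c) = x a * f (e a) + 1 * f ?Y"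
    by (rule f[unfolded linear_at_def, rule_format, OF e conjunct1[OF insert.IH]])
  then show ?case
    using insert tangent_space_combination[OF M e conjunct1[OF insert.IH], of "x a" a 1] by simp
qed

subsection \<open>The higher spin representation\<close>

lemma matrix_inv_eqI:
  fixes A B :: "'a::semiring_1^'n^'n"
  assumes "A ** B = mat 1" and "B ** A = mat 1"
  shows "matrix_inv A = B"
proof -
  have "A ** matrix_inv A = mat 1 \<and> matrix_inv A ** A = mat 1"
    unfolding matrix_inv_def by (rule someI[of _ B]) (use assms in blast)
  then show ?thesis
    by (metis assms(2) matrix_mul_assoc matrix_mul_lid matrix_mul_rid)
qed

text \<open>On \<open>SL2C\<close> this is the inverse. Its entries are linear in those of
  \<open>S\<close>, which gives smoothness of inverse transition functions directly.\<close>

definition adjugate2 :: "complex^2^2 \<Rightarrow> complex^2^2" where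
  "adjugate2 S = vector [vector [S$2$2, - S$1$2], vector [- S$2$1, S$1$1]]"

lemma adjugate2_entries:
  "adjugate2 S $ 1 $ 1 = S$2$2" "adjugate2 S $ 1 $ 2 = - S$1$2"
  "adjugate2 S $ 2 $ 1 = - S$2$1" "adjugate2 S $ 2 $ 2 = S$1$1"
  by (simp_all add: adjugate2_def)

lemma matrix_inv_SL2C: "S \<in> SL2C \<Longrightarrow> matrix_inv S = adjugate2 S"
  by (rule matrix_inv_eqI)
    (simp_all add: vec_eq_iff forall_2 matrix_matrix_mult_def sum_2 adjugate2_entries mat_def
      SL2C_def det_2 algebra_simps)

lemma SL2C_mult: "S \<in> SL2C \<Longrightarrow> T \<in> SL2C \<Longrightarrow> S ** T \<in> SL2C"
  by (simp add: SL2C_def det_mul)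

lemma SL2C_one: "mat 1 \<in> SL2C"
  by (simp add: SL2C_def)

lemma SL2C_inv: "S \<in> SL2C \<Longrightarrow> matrix_inv S \<in> SL2C"
  unfolding matrix_inv_SL2C by (simp add: SL2C_def det_2 adjugate2_entries algebra_simps)

lemma matrix_inv_mult_SL2C:
  "S \<in> SL2C \<Longrightarrow> T \<in> SL2C \<Longrightarrow> matrix_inv (S ** T) = matrix_inv T ** matrix_inv S"
  by (simp add: matrix_inv_SL2C SL2C_mult)
    (simp add: vec_eq_iff forall_2 matrix_matrix_mult_def sum_2 adjugate2_entries algebra_simps)

lemma matrix_inv_one: "matrix_inv (mat 1 :: complex^2^2) = mat 1"
  by (rule matrix_inv_eqI) simp_all

text \<open>Inversion and transposition each reverse the order of a product, so together they
  preserve it.\<close>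

lemma dual_conj_mult:
  assumes "S \<in> SL2C" and "T \<in> SL2C"
  shows "dual_conj (S ** T) = dual_conj S ** dual_conj T"
  unfolding dual_conj_def matrix_inv_mult_SL2C[OF assms]
  by (simp add: vec_eq_iff matrix_matrix_mult_def transpose_def mult.commute)

lemma dual_conj_one: "dual_conj (mat 1) = mat 1"
  unfolding dual_conj_def matrix_inv_one by (auto simp: vec_eq_iff transpose_def mat_def)

text \<open>Equivariance always acts with \<open>matrix_inv S\<close>. On dotted indices the two
  inversions cancel and only the Hermitian adjoint is left, whose entries are conjugates of those of
  \<open>S\<close>.\<close>

lemma dual_conj_inv:
  assumes "S \<in> SL2C"
  shows "dual_conj (matrix_inv S) = adjoint_mat S"
proof -
  have "matrix_inv (matrix_inv S) = S"
    unfolding matrix_inv_SL2C[OF SL2C_inv[OF assms]] unfolding matrix_inv_SL2C[OF assms]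
    by (simp add: vec_eq_iff forall_2 adjugate2_entries)
  then show ?thesis by (simp add: dual_conj_def adjoint_mat_def vec_eq_iff transpose_def)
qed

lemma sum_UNIV_Plus:
  fixes f :: "'a::finite + 'b::finite \<Rightarrow> 'c::comm_monoid_add"
  shows "(\<Sum>i\<in>UNIV. f i) = (\<Sum>a\<in>UNIV. f (Inl a)) + (\<Sum>b\<in>UNIV. f (Inr b))"
  by (simp add: UNIV_Plus_UNIV[symmetric] sum.Plus del: UNIV_Plus_UNIV)

section \<open>Sums over multi-indices\<close>

lemma finite_multi_index: "finite (multi_index k)"
  unfolding multi_index_def using finite_lists_length_eq[of "UNIV :: 2 set" k] by simp

lemma multi_index_Suc: "multi_index (Suc k) = (\<lambda>(b, Bs). b # Bs) ` (UNIV \<times> multi_index k)"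
  by (auto simp: multi_index_def image_iff length_Suc_conv)

text \<open>The distributive law, by splitting off the first index. It is what makes tensor powers
  of matrices multiplicative.\<close>

lemma sum_multi_index_prod:
  fixes f :: "nat \<Rightarrow> 2 \<Rightarrow> 'a::comm_semiring_1"
  shows "(\<Sum>Bs\<in>multi_index k. \<Prod>n<k. f n (Bs ! n)) = (\<Prod>n<k. \<Sum>b\<in>UNIV. f n b)"
proof (induction k arbitrary: f)
  case 0
  then show ?case by (simp add: multi_index_def)
next
  case (Suc k)
  have inj: "inj_on (\<lambda>(b, Bs). b # Bs) (UNIV \<times> multi_index k)"
    by (auto simp: inj_on_def)
  have "(\<Sum>Bs\<in>multi_index (Suc k). \<Prod>n<Suc k. f n (Bs ! n))
      = (\<Sum>b\<in>UNIV. \<Sum>Bs\<in>multi_index k. f 0 b * (\<Prod>n<k. f (Suc n) (Bs ! n)))"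
    unfolding multi_index_Suc
    by (subst sum.reindex[OF inj])
      (simp add: sum.cartesian_product prod.lessThan_Suc_shift case_prod_unfold del: prod.lessThan_Suc)
  also have "\<dots> = (\<Sum>b\<in>UNIV. f 0 b) * (\<Sum>Bs\<in>multi_index k. \<Prod>n<k. f (Suc n) (Bs ! n))"
    by (simp add: sum_product)
  also have "\<dots> = (\<Prod>n<Suc k. \<Sum>b\<in>UNIV. f n b)"
    using Suc[of "\<lambda>n. f (Suc n)"] by (simp add: prod.lessThan_Suc_shift del: prod.lessThan_Suc)
  finally show ?case .
qed

text \<open>A permutation taking \<open>As'\<close> to \<open>As\<close> can be applied to the
  summation index too. The product is unchanged when both of its lists are permuted together, and
  \<open>G\<close> does not see the order of its argument.\<close>

lemma sum_multi_index_perm: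
  fixes f :: "2 \<Rightarrow> 2 \<Rightarrow> 'a::comm_semiring_1"
  assumes As: "As \<in> multi_index k" and mset: "mset As = mset As'"
    and G: "\<And>Bs Bs'. mset Bs = mset Bs' \<Longrightarrow> G Bs = G Bs'"
  shows "(\<Sum>Bs\<in>multi_index k. (\<Prod>n<k. f (As ! n) (Bs ! n)) * G Bs)
    = (\<Sum>Bs\<in>multi_index k. (\<Prod>n<k. f (As' ! n) (Bs ! n)) * G Bs)"
proof -
  have len: "length As = k" "length As' = k"
    using As mset by (auto simp: multi_index_def dest: mset_eq_length)
  obtain \<pi> where \<pi>: "\<pi> permutes {..<k}" "permute_list \<pi> As' = As"
    using mset_eq_permutation[OF mset] len by metis
  have inj: "inj_on (permute_list \<pi>) (multi_index k)"
  proof (rule inj_onI, rule nth_equalityI)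
    fix xs ys :: "2 list" and i
    assume xs: "xs \<in> multi_index k" "ys \<in> multi_index k" "permute_list \<pi> xs = permute_list \<pi> ys"
    then show "length xs = length ys" by (simp add: multi_index_def)
    assume i: "i < length xs"
    then have "i \<in> \<pi> ` {..<k}"
      using xs(1) by (simp add: multi_index_def permutes_image[OF \<pi>(1)])
    then obtain j where j: "j < k" "\<pi> j = i" by blast
    then show "xs ! i = ys ! i"
      using permute_list_nth[of \<pi> xs j] permute_list_nth[of \<pi> ys j] \<pi>(1) xs
      by (simp add: multi_index_def)
  qed
  \<comment> \<open>An injective map of a finite set into itself is onto, so the reindexing runs
    over the same set.\<close>
  have img: "permute_list \<pi> ` multi_index k = multi_index k"
    by (rule endo_inj_surj[OF finite_multi_index _ inj]) (auto simp: multi_index_def)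
  have "(\<Sum>Bs\<in>multi_index k. (\<Prod>n<k. f (As ! n) (Bs ! n)) * G Bs)
      = (\<Sum>Bs\<in>multi_index k. (\<Prod>n<k. f (As ! n) (permute_list \<pi> Bs ! n)) * G (permute_list \<pi> Bs))"
    using sum.reindex[OF inj, of "\<lambda>Bs. (\<Prod>n<k. f (As ! n) (Bs ! n)) * G Bs"]
    by (simp add: img comp_def)
  also have "\<dots> = (\<Sum>Bs\<in>multi_index k. (\<Prod>n<k. f (As' ! n) (Bs ! n)) * G Bs)"
  proof (rule sum.cong[OF refl])
    fix Bs :: "2 list" assume Bs: "Bs \<in> multi_index k"
    have "(\<Prod>n<k. f (As ! n) (permute_list \<pi> Bs ! n)) = (\<Prod>n<k. f (As' ! \<pi> n) (Bs ! \<pi> n))"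
      using Bs \<pi> len permute_list_nth[of \<pi> As'] permute_list_nth[of \<pi> Bs]
      by (intro prod.cong) (auto simp: multi_index_def)
    also have "\<dots> = (\<Prod>n<k. f (As' ! n) (Bs ! n))"
      using prod.permute[OF \<pi>(1), of "\<lambda>n. f (As' ! n) (Bs ! n)"] by (simp add: comp_def)
    moreover have "G (permute_list \<pi> Bs) = G Bs"
      using \<pi>(1) Bs by (intro G mset_permute_list) (simp add: multi_index_def)
    ultimately show "(\<Prod>n<k. f (As ! n) (permute_list \<pi> Bs ! n)) * G (permute_list \<pi> Bs)
      = (\<Prod>n<k. f (As' ! n) (Bs ! n)) * G Bs" by simp
  qed
  finally show ?thesis .
qed

definition spin_indices :: "nat \<Rightarrow> spin_index set" where
  "spin_indices k = UNIV \<times> multi_index k \<times> multi_index k"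

text \<open>The matrix of the representation on the full tensor product. With it, composing actions
  becomes matrix multiplication over \<open>spin_indices k\<close>.\<close>

definition spin_kernel :: "nat \<Rightarrow> complex^2^2 \<Rightarrow> spin_index \<Rightarrow> spin_index \<Rightarrow> complex" where
  "spin_kernel k S = (\<lambda>(i, As, Xs) (j, Bs, Ys). block_mat S 0 0 (dual_conj S) $ i $ j *
     (\<Prod>n<k. S $ (As!n) $ (Bs!n)) * (\<Prod>n<k. dual_conj S $ (Xs!n) $ (Ys!n)))"

lemma finite_spin_indices: "finite (spin_indices k)"
  by (simp add: spin_indices_def finite_multi_index)

lemma sum_spin_indices:
  "(\<Sum>y\<in>spin_indices k. f y)
    = (\<Sum>j\<in>UNIV. \<Sum>Bs\<in>multi_index k. \<Sum>Ys\<in>multi_index k. f (j, Bs, Ys))"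
  by (simp add: spin_indices_def sum.cartesian_product case_prod_unfold)

lemma higher_spin_act_eq:
  "higher_spin_act k S \<phi> x
    = (if x \<in> spin_indices k then \<Sum>y\<in>spin_indices k. spin_kernel k S x y * \<phi> y else 0)"
proof (cases x)
  case (fields i As Xs)
  then have "x \<in> spin_indices k \<longleftrightarrow> As \<in> multi_index k \<and> Xs \<in> multi_index k"
    by (simp add: spin_indices_def)
  then show ?thesis
    by (simp add: fields higher_spin_act_def sum_spin_indices spin_kernel_def)
qed

lemma block_mat_diag_mult:
  "block_mat S 0 0 D ** block_mat T 0 0 E = block_mat (S ** T) 0 0 (D ** E)"
  by (auto simp: vec_eq_iff matrix_matrix_mult_def sum_UNIV_Plus block_mat_def split: sum.splits)

lemma block_mat_one: "block_mat (mat 1) 0 0 (mat 1) = mat 1"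
  by (auto simp: vec_eq_iff block_mat_def mat_def split: sum.splits)

text \<open>The sum over the intermediate index factors into independent sums for the Dirac index,
  the undotted and the dotted multi-index; each is a product of matrices, and
  \<open>dual_conj\<close> is multiplicative.\<close>

lemma spin_kernel_mult:
  assumes "S \<in> SL2C" and "T \<in> SL2C"
  shows "(\<Sum>y\<in>spin_indices k. spin_kernel k S x y * spin_kernel k T y z) = spin_kernel k (S ** T) x z"
proof -
  obtain i As Xs l Cs Zs where x: "x = (i, As, Xs)" and z: "z = (l, Cs, Zs)"
    by (metis prod_cases3)
  let ?D = "dual_conj S" and ?E = "dual_conj T"
  let ?P = "block_mat S 0 0 ?D" and ?Q = "block_mat T 0 0 ?E"
  have "(\<Sum>y\<in>spin_indices k. spin_kernel k S x y * spin_kernel k T y z)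
    = (\<Sum>j\<in>UNIV. \<Sum>Bs\<in>multi_index k. \<Sum>Ys\<in>multi_index k. (?P$i$j * ?Q$j$l) *
        ((\<Prod>n<k. S$(As!n)$(Bs!n) * T$(Bs!n)$(Cs!n)) *
        (\<Prod>n<k. ?D$(Xs!n)$(Ys!n) * ?E$(Ys!n)$(Zs!n))))"
    unfolding sum_spin_indices x z spin_kernel_def prod.distrib by (simp add: mult_ac)
  also have "\<dots> = (\<Sum>j\<in>UNIV. ?P$i$j * ?Q$j$l) *
      ((\<Sum>Bs\<in>multi_index k. \<Prod>n<k. S$(As!n)$(Bs!n) * T$(Bs!n)$(Cs!n)) *
      (\<Sum>Ys\<in>multi_index k. \<Prod>n<k. ?D$(Xs!n)$(Ys!n) * ?E$(Ys!n)$(Zs!n)))"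
    by (simp add: sum_distrib_left[symmetric] sum_distrib_right[symmetric])
  also have "\<dots> = (?P ** ?Q)$i$l * ((\<Prod>n<k. (S ** T)$(As!n)$(Cs!n)) * (\<Prod>n<k. (?D ** ?E)$(Xs!n)$(Zs!n)))"
    using sum_multi_index_prod[of "\<lambda>n b. S$(As!n)$b * T$b$(Cs!n)" k]
      sum_multi_index_prod[of "\<lambda>n b. ?D$(Xs!n)$b * ?E$b$(Zs!n)" k]
    by (simp add: matrix_matrix_mult_def)
  finally show ?thesis
    by (simp add: x z spin_kernel_def block_mat_diag_mult dual_conj_mult[OF assms])
qed

lemma higher_spin_act_mult:
  assumes "S \<in> SL2C" and "T \<in> SL2C"
  shows "higher_spin_act k S (higher_spin_act k T \<phi>) = higher_spin_act k (S ** T) \<phi>"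
proof
  fix x
  have "(\<Sum>y\<in>spin_indices k. spin_kernel k S x y * (\<Sum>z\<in>spin_indices k. spin_kernel k T y z * \<phi> z))
    = (\<Sum>z\<in>spin_indices k. (\<Sum>y\<in>spin_indices k. spin_kernel k S x y * spin_kernel k T y z) * \<phi> z)"
    unfolding sum_distrib_left sum_distrib_right by (subst sum.swap) (simp add: mult.assoc)
  then show "higher_spin_act k S (higher_spin_act k T \<phi>) x = higher_spin_act k (S ** T) \<phi> x"
    by (simp add: higher_spin_act_eq spin_kernel_mult[OF assms] cong: sum.cong)
qed

lemma prod_mat_one:
  assumes "As \<in> multi_index k" and "Bs \<in> multi_index k"
  shows "(\<Prod>n<k. (mat 1 :: complex^2^2) $ (As!n) $ (Bs!n)) = of_bool (As = Bs)"
  using assms by (auto simp: mat_def multi_index_def list_eq_iff_nth_eq prod_zero_iff)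

lemma higher_spin_spaceI:
  assumes "\<And>i As Xs. As \<notin> multi_index k \<or> Xs \<notin> multi_index k \<Longrightarrow> \<phi> (i, As, Xs) = 0"
    and "\<And>i As Xs As' Xs'. mset As = mset As' \<Longrightarrow> mset Xs = mset Xs' \<Longrightarrow>
      \<phi> (i, As, Xs) = \<phi> (i, As', Xs')"
  shows "\<phi> \<in> higher_spin_space k"
  unfolding higher_spin_space_def
  by (intro CollectI conjI allI impI; (elim conjE)?) (rule assms; assumption)+

lemma higher_spin_spaceD:
  assumes "\<phi> \<in> higher_spin_space k"
  shows "As \<notin> multi_index k \<or> Xs \<notin> multi_index k \<Longrightarrow> \<phi> (i, As, Xs) = 0"
    and "mset As = mset As' \<Longrightarrow> mset Xs = mset Xs' \<Longrightarrow> \<phi> (i, As, Xs) = \<phi> (i, As', Xs')"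
  using assms unfolding higher_spin_space_def by blast+

lemma higher_spin_act_one:
  assumes "\<phi> \<in> higher_spin_space k"
  shows "higher_spin_act k (mat 1) \<phi> = \<phi>"
proof
  fix x
  show "higher_spin_act k (mat 1) \<phi> x = \<phi> x"
  proof (cases "x \<in> spin_indices k")
    case True
    have "spin_kernel k (mat 1) x y = of_bool (y = x)" if "y \<in> spin_indices k" for y
      using True that
      by (auto simp: spin_indices_def spin_kernel_def prod_mat_one block_mat_one dual_conj_one)
        (auto simp: mat_def split: if_splits)
    then have "(\<Sum>y\<in>spin_indices k. spin_kernel k (mat 1) x y * \<phi> y)
        = (\<Sum>y\<in>spin_indices k. if y = x then \<phi> y else 0)"
      by (intro sum.cong) auto
    then show ?thesis using True by (simp add: higher_spin_act_eq finite_spin_indices)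
  next
    \<comment> \<open>Outside the index set the action returns 0 by convention, and elements of the
      space vanish there by definition.\<close>
    case False
    then show ?thesis using higher_spin_spaceD(1)[OF assms]
      by (cases x) (auto simp: higher_spin_act_eq spin_indices_def)
  qed
qed

text \<open>All slots of one kind are acted on by the same matrix, so permuting the free indices can
  be absorbed by permuting the summed ones, where the argument is symmetric.\<close>

lemma higher_spin_act_in_space:
  assumes "\<phi> \<in> higher_spin_space k"
  shows "higher_spin_act k S \<phi> \<in> higher_spin_space k"
proof -
  have sym: "\<phi> (j, Bs, Ys) = \<phi> (j, Bs', Ys')" if "mset Bs = mset Bs'" "mset Ys = mset Ys'"
    for j Bs Ys Bs' Ys'
    using higher_spin_spaceD(2)[OF assms that] .
  have mset: "higher_spin_act k S \<phi> (i, As, Xs) = higher_spin_act k S \<phi> (i, As', Xs')"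
    if m: "mset As = mset As'" "mset Xs = mset Xs'" for i As Xs As' Xs'
  proof (cases "As \<in> multi_index k \<and> Xs \<in> multi_index k")
    case True
    have mi: "As' \<in> multi_index k" "Xs' \<in> multi_index k"
      using True m by (auto simp: multi_index_def dest: mset_eq_length)
    let ?D = "dual_conj S"
    \<comment> \<open>The dotted sum is nested inside the undotted one, so that
      \<open>sum_multi_index_perm\<close> applies to each in turn: first \<open>Xs\<close> is
      replaced by \<open>Xs'\<close>, then \<open>As\<close> by \<open>As'\<close>.\<close>
    define G where "G Xs j Bs = (\<Sum>Ys\<in>multi_index k. (\<Prod>n<k. ?D$(Xs!n)$(Ys!n)) * \<phi> (j, Bs, Ys))"
      for Xs j Bs
    define H where "H As Xs j = (\<Sum>Bs\<in>multi_index k. (\<Prod>n<k. S$(As!n)$(Bs!n)) * G Xs j Bs)"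
      for As Xs j
    have act: "higher_spin_act k S \<phi> (i, As, Xs) = (\<Sum>j\<in>UNIV. block_mat S 0 0 ?D $ i $ j * H As Xs j)"
      if "As \<in> multi_index k" "Xs \<in> multi_index k" for As Xs
      using that by (simp add: higher_spin_act_def H_def G_def sum_distrib_left mult.assoc)
    have "G Xs j Bs = G Xs' j Bs" for j Bs
      unfolding G_def using True m
      by (intro sum_multi_index_perm[where f = "\<lambda>a b. ?D$a$b"]) (auto intro: sym)
    moreover have "H As Xs' j = H As' Xs' j" for j
      unfolding H_def using True m
      by (intro sum_multi_index_perm[where f = "\<lambda>a b. S$a$b"])
        (auto simp: G_def intro!: sum.cong arg_cong2[where f = "(*)"] sym)
    ultimately show ?thesis by (simp only: act True mi H_def)
  next
    case False
    then have "\<not> (As' \<in> multi_index k \<and> Xs' \<in> multi_index k)"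
      using m by (auto simp: multi_index_def dest: mset_eq_length)
    then show ?thesis using False by (auto simp: higher_spin_act_def)
  qed
  show ?thesis
  proof (rule higher_spin_spaceI)
    show "higher_spin_act k S \<phi> (i, As, Xs) = 0"
      if "As \<notin> multi_index k \<or> Xs \<notin> multi_index k" for i As Xs
      using that by (auto simp: higher_spin_act_def)
  qed (rule mset)
qed

lemma higher_spin_act_linear:
  "higher_spin_act k S (\<lambda>i. a * \<phi> i + b * \<psi> i)
    = (\<lambda>i. a * higher_spin_act k S \<phi> i + b * higher_spin_act k S \<psi> i)"
  by (simp add: fun_eq_iff higher_spin_act_eq sum.distrib sum_distrib_left algebra_simps)

text \<open>Used pointwise with \<open>a\<close> the value of a function: the connection term is
  linear over functions and so contributes nothing to the symbol.\<close>

lemma higher_spin_act_deriv_scale: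
  "higher_spin_act_deriv k B (\<lambda>i. a * \<phi> i) = (\<lambda>i. a * higher_spin_act_deriv k B \<phi> i)"
  by (auto simp: fun_eq_iff higher_spin_act_deriv_def sum_distrib_left distrib_left
      mult.left_commute[of _ a])

lemma higher_spin_space_linear:
  assumes "\<phi> \<in> higher_spin_space k" and "\<psi> \<in> higher_spin_space k"
  shows "(\<lambda>i. a * \<phi> i + b * \<psi> i) \<in> higher_spin_space k"
proof (rule higher_spin_spaceI)
  fix i :: "2 + 2" and As As' Xs Xs' :: "2 list"
  assume "mset As = mset As'" and "mset Xs = mset Xs'"
  then show "a * \<phi> (i, As, Xs) + b * \<psi> (i, As, Xs) = a * \<phi> (i, As', Xs') + b * \<psi> (i, As', Xs')"
    using higher_spin_spaceD(2)[OF assms(1)] higher_spin_spaceD(2)[OF assms(2)]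
    by (intro arg_cong2[where f = "\<lambda>x y. a * x + b * y"])
next
  fix i :: "2 + 2" and As Xs :: "2 list"
  assume "As \<notin> multi_index k \<or> Xs \<notin> multi_index k"
  then show "a * \<phi> (i, As, Xs) + b * \<psi> (i, As, Xs) = 0"
    by (simp only: assms[THEN higher_spin_spaceD(1)]) simp
qed

subsection \<open>Extension of fibre vectors to local sections\<close>

text \<open>Only meaningful for points over the same base point.\<close>

definition transport ::
  "('m, 's, 'z) spin_spacetime_scheme \<Rightarrow> 's \<Rightarrow> 's \<Rightarrow> complex^2^2" where
  "transport M s t = (THE S. S \<in> SL2C \<and> t = act M s S)"

text \<open>The section with constant components \<open>\<phi>\<close> along
  \<open>\<sigma>\<close>; equivariance forces its value at every other point of the fibre.\<close>

definition extend_section ::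
  "('m, 's, 'z) spin_spacetime_scheme \<Rightarrow> nat \<Rightarrow> ('m \<Rightarrow> 's) \<Rightarrow> (spin_index \<Rightarrow> complex)
     \<Rightarrow> ('s, spin_index) bundle_fun" where
  "extend_section M k \<sigma> \<phi> = (\<lambda>s. higher_spin_act k (matrix_inv (transport M (\<sigma> (proj M s)) s)) \<phi>)"

section \<open>Consequences of the axioms of a spin structure\<close>

context
  fixes M :: "('m::topological_space, 's, 'z) spin_spacetime_scheme"
  assumes spin: "spin_structure M"
begin

lemma act_act: "S \<in> SL2C \<Longrightarrow> T \<in> SL2C \<Longrightarrow> act M (act M s S) T = act M s (S ** T)"
  using spin by (simp add: spin_structure_def)

lemma proj_act: "S \<in> SL2C \<Longrightarrow> proj M (act M s S) = proj M s"
  using spin by (simp add: spin_structure_def)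

lemma sections_proj: "(U, \<sigma>) \<in> sections M \<Longrightarrow> p \<in> U \<Longrightarrow> proj M (\<sigma> p) = p"
  and sections_open: "(U, \<sigma>) \<in> sections M \<Longrightarrow> open U"
  using spin by (auto simp: spin_structure_def)

lemma ex_section: "\<exists>U \<sigma>. (U, \<sigma>) \<in> sections M \<and> p \<in> U"
proof -
  have "\<exists>(U, \<sigma>)\<in>sections M. p \<in> U" using spin by (simp add: spin_structure_def)
  then show ?thesis by blast
qed

lemma section_transition:
  assumes "(U, \<sigma>) \<in> sections M" and "(W, \<tau>) \<in> sections M"
  obtains S where "\<And>q. q \<in> U \<inter> W \<Longrightarrow> S q \<in> SL2C \<and> \<tau> q = act M (\<sigma> q) (S q)"
    and "\<And>i j. smooth_fun_on M (U \<inter> W) (\<lambda>q. S q $ i $ j)"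
proof -
  have "\<forall>(U, \<sigma>)\<in>sections M. \<forall>(U', \<sigma>')\<in>sections M. \<exists>S.
      (\<forall>p\<in>U \<inter> U'. S p \<in> SL2C \<and> \<sigma>' p = act M (\<sigma> p) (S p)) \<and>
      (\<forall>i j. smooth_fun_on M (U \<inter> U') (\<lambda>p. S p $ i $ j))"
    using spin unfolding spin_structure_def by (elim conjE)
  with assms have "\<exists>S. (\<forall>q\<in>U \<inter> W. S q \<in> SL2C \<and> \<tau> q = act M (\<sigma> q) (S q)) \<and>
      (\<forall>i j. smooth_fun_on M (U \<inter> W) (\<lambda>q. S q $ i $ j))"
    by blast
  then show ?thesis using that by blast
qed

lemma frame_map_oriented: "frame_map M s \<in> oriented_frames M (proj M s)"
  using spin by (simp add: spin_structure_def)

lemma transport_unique: "proj M s = proj M t \<Longrightarrow> \<exists>!S. S \<in> SL2C \<and> t = act M s S"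
  using spin by (simp add: spin_structure_def)

lemma transport:
  assumes "proj M s = proj M t"
  shows "transport M s t \<in> SL2C" and "act M s (transport M s t) = t"
  using theI'[OF transport_unique[OF assms]] by (simp_all add: transport_def)

lemma transport_act: "S \<in> SL2C \<Longrightarrow> transport M s (act M s S) = S"
  using transport_unique[of s "act M s S"] unfolding transport_def
  by (auto simp: proj_act intro!: the1_equality)

lemma extend_section_act:
  assumes "proj M (\<sigma> p) = p" and "S \<in> SL2C"
  shows "extend_section M k \<sigma> \<phi> (act M (\<sigma> p) S) = higher_spin_act k (matrix_inv S) \<phi>"
  using assms by (simp add: extend_section_def proj_act transport_act)

text \<open>If \<open>s\<close> is \<open>\<sigma> p\<close> moved by \<open>S\<close>, then
  \<open>s\<close> moved by \<open>T\<close> is \<open>\<sigma> p\<close> moved by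
  \<open>S ** T\<close>, and the inverse of this product acts as first \<open>matrix_inv S\<close>,
  then \<open>matrix_inv T\<close>.\<close>

lemma equivariant_extend_section:
  assumes "\<And>q. q \<in> U \<Longrightarrow> proj M (\<sigma> q) = q" and \<phi>: "\<phi> \<in> higher_spin_space k"
  shows "equivariant_over M (higher_spin k) U (extend_section M k \<sigma> \<phi>)"
  unfolding equivariant_over_def higher_spin_def fst_conv snd_conv
proof (intro allI impI conjI ballI)
  fix s assume s: "proj M s \<in> U"
  show "extend_section M k \<sigma> \<phi> s \<in> higher_spin_space k"
    by (simp add: extend_section_def higher_spin_act_in_space \<phi>)
  fix T assume T: "T \<in> SL2C"
  define S where "S = transport M (\<sigma> (proj M s)) s"
  have S: "S \<in> SL2C" "s = act M (\<sigma> (proj M s)) S"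
    using transport[of "\<sigma> (proj M s)" s] assms(1)[OF s] by (auto simp: S_def)
  have "extend_section M k \<sigma> \<phi> (act M s T)
      = extend_section M k \<sigma> \<phi> (act M (\<sigma> (proj M s)) (S ** T))"
    using S T act_act by metis
  also have "\<dots> = higher_spin_act k (matrix_inv T) (higher_spin_act k (matrix_inv S) \<phi>)"
    using S(1) T assms(1)[OF s]
    by (simp add: extend_section_act SL2C_mult higher_spin_act_mult SL2C_inv matrix_inv_mult_SL2C)
  finally show "extend_section M k \<sigma> \<phi> (act M s T)
      = higher_spin_act k (matrix_inv T) (extend_section M k \<sigma> \<phi> s)"
    by (simp add: extend_section_def S_def)
qed

lemma restrict_fibre_in_fibre:
  assumes "equivariant_over M E {p} \<Phi>"
  shows "restrict_fibre M p \<Phi> \<in> fibre M E p"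
  using assms by (simp add: fibre_def restrict_fibre_def equivariant_over_def proj_act)

text \<open>Shows that every fibre vector is the value of a local section. Both sides are
  equivariant on the fibre over \<open>p\<close> and agree at \<open>\<sigma> p\<close>, and the
  action is transitive there.\<close>

lemma restrict_fibre_extend_section:
  assumes v: "v \<in> fibre M (higher_spin k) p" and \<sigma>: "proj M (\<sigma> p) = p"
  shows "restrict_fibre M p (extend_section M k \<sigma> (v (\<sigma> p))) = v"
proof
  fix s
  show "restrict_fibre M p (extend_section M k \<sigma> (v (\<sigma> p))) s = v s"
  proof (cases "proj M s = p")
    case True
    define S where "S = transport M (\<sigma> p) s"
    have S: "S \<in> SL2C" "act M (\<sigma> p) S = s"
      using transport[of "\<sigma> p" s] \<sigma> True by (simp_all add: S_def)
    have "v (act M (\<sigma> p) S) = higher_spin_act k (matrix_inv S) (v (\<sigma> p))"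
      using v S(1) \<sigma> by (simp add: fibre_def equivariant_over_def higher_spin_def)
    then show ?thesis
      using extend_section_act[of \<sigma> p S, OF \<sigma> S(1)] True S(2) by (simp add: restrict_fibre_def)
  qed (use v in \<open>simp add: restrict_fibre_def fibre_def\<close>)
qed

lemma ex_fibre_value:
  assumes "\<phi> \<in> higher_spin_space k"
  shows "\<exists>v\<in>fibre M (higher_spin k) (proj M s). v s = \<phi>"
proof
  \<comment> \<open>The constant map to \<open>s\<close> is a section over the single base point of
    \<open>s\<close>, which is enough to define one fibre vector.\<close>
  let ?\<Phi> = "extend_section M k (\<lambda>_. s) \<phi>"
  show "restrict_fibre M (proj M s) ?\<Phi> \<in> fibre M (higher_spin k) (proj M s)"
    using assms by (intro restrict_fibre_in_fibre equivariant_extend_section) auto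
  have "act M s (mat 1) = s" using spin by (simp add: spin_structure_def)
  then show "restrict_fibre M (proj M s) ?\<Phi> s = \<phi>"
    using extend_section_act[of "\<lambda>_. s" "proj M s" "mat 1" k \<phi>] assms
    by (simp add: restrict_fibre_def SL2C_one matrix_inv_one higher_spin_act_one)
qed

text \<open>Along another section \<open>\<tau>\<close>, which is \<open>\<sigma>\<close> moved by a
  smooth \<open>S\<close>, the components are polynomials in the entries of
  \<open>adjugate2 (S q)\<close> and \<open>adjoint_mat (S q)\<close>.\<close>

lemma smooth_extend_section:
  assumes M: "smooth_manifold M" and \<sigma>: "(V, \<sigma>) \<in> sections M" and U: "open U" "U \<subseteq> V"
    and \<phi>: "\<phi> \<in> higher_spin_space k"
  shows "smooth_section_on M (higher_spin k) U (extend_section M k \<sigma> \<phi>)"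
  unfolding smooth_section_on_def
proof (intro conjI allI ballI, safe)
  show "equivariant_over M (higher_spin k) U (extend_section M k \<sigma> \<phi>)"
    using U sections_proj[OF \<sigma>] by (intro equivariant_extend_section \<phi>) blast
next
  fix W \<tau> i As Xs assume \<tau>: "(W, \<tau>) \<in> sections M"
  obtain S where S: "\<And>q. q \<in> V \<inter> W \<Longrightarrow> S q \<in> SL2C \<and> \<tau> q = act M (\<sigma> q) (S q)"
    and S_smooth: "\<And>i j. smooth_fun_on M (V \<inter> W) (\<lambda>q. S q $ i $ j)"
    using section_transition[OF \<sigma> \<tau>] by blast
  have O: "open (U \<inter> W)" using U sections_open[OF \<tau>] by blast
  have S_sm: "smooth_fun_on M (U \<inter> W) (\<lambda>q. S q $ i $ j)" for i j
    by (rule smooth_fun_on_mono[OF S_smooth]) (use U in blast)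
  have adj: "smooth_fun_on M (U \<inter> W) (\<lambda>q. adjugate2 (S q) $ i $ j)" for i j
    using exhaust_2[of i] exhaust_2[of j] S_sm
      smooth_fun_on_bounded_linear[OF M O bounded_linear_minus[OF bounded_linear_ident] S_sm]
    by (auto simp: adjugate2_entries)
  have cnj: "smooth_fun_on M (U \<inter> W) (\<lambda>q. adjoint_mat (S q) $ i $ j)" for i j
    using smooth_fun_on_bounded_linear[OF M O bounded_linear_cnj S_sm]
    by (simp add: adjoint_mat_def)
  have block: "smooth_fun_on M (U \<inter> W)
      (\<lambda>q. block_mat (adjugate2 (S q)) 0 0 (adjoint_mat (S q)) $ i $ j)" for i j
    by (cases i; cases j) (simp_all add: block_mat_def adj cnj smooth_fun_on_const[OF M O])
  have "smooth_fun_on M (U \<inter> W) (\<lambda>q.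
      if As \<in> multi_index k \<and> Xs \<in> multi_index k
      then \<Sum>j\<in>UNIV. \<Sum>Bs\<in>multi_index k. \<Sum>Ys\<in>multi_index k.
            block_mat (adjugate2 (S q)) 0 0 (adjoint_mat (S q)) $ i $ j *
            (\<Prod>n<k. adjugate2 (S q) $ (As!n) $ (Bs!n)) *
            (\<Prod>n<k. adjoint_mat (S q) $ (Xs!n) $ (Ys!n)) * \<phi> (j, Bs, Ys)
      else 0)"
    by (cases "As \<in> multi_index k"; cases "Xs \<in> multi_index k")
      (simp_all add: smooth_fun_on_const[OF M O] smooth_fun_on_sum[OF M O] smooth_fun_on_mult[OF M O]
        smooth_fun_on_prod[OF M O] block adj cnj)
  then show "smooth_fun_on M (U \<inter> W) (\<lambda>q. extend_section M k \<sigma> \<phi> (\<tau> q) (i, As, Xs))"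
  proof (rule smooth_fun_on_cong[OF M O, rotated])
    fix q assume q: "q \<in> U \<inter> W"
    then have "extend_section M k \<sigma> \<phi> (\<tau> q) = higher_spin_act k (matrix_inv (S q)) \<phi>"
      using U S[of q] extend_section_act[of \<sigma> q "S q" k \<phi>] sections_proj[OF \<sigma>, of q] by auto
    moreover have "S q \<in> SL2C" using q U S by blast
    ultimately show "(if As \<in> multi_index k \<and> Xs \<in> multi_index k
      then \<Sum>j\<in>UNIV. \<Sum>Bs\<in>multi_index k. \<Sum>Ys\<in>multi_index k.
            block_mat (adjugate2 (S q)) 0 0 (adjoint_mat (S q)) $ i $ j *
            (\<Prod>n<k. adjugate2 (S q) $ (As!n) $ (Bs!n)) *
            (\<Prod>n<k. adjoint_mat (S q) $ (Xs!n) $ (Ys!n)) * \<phi> (j, Bs, Ys)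
      else 0) = extend_section M k \<sigma> \<phi> (\<tau> q) (i, As, Xs)"
      by (simp add: higher_spin_act_def dual_conj_inv matrix_inv_SL2C[symmetric])
  qed
qed

end

subsection \<open>The principal symbol\<close>

lemma chart_at: "smooth_manifold M \<Longrightarrow> chart_at M p \<in> charts_at M p"
  unfolding chart_at_def smooth_manifold_def by (metis all_not_in_conv someI_ex)

text \<open>The product formula for \<open>h\<close> is required near \<open>p\<close> only:
  \<open>fun_times_section\<close> evaluates \<open>f\<close> at \<open>proj M (\<sigma> q)\<close>,
  which is \<open>q\<close> just on the domain of \<open>\<sigma>\<close>.\<close>

lemma dir_deriv_mult:
  fixes f :: "'m::topological_space \<Rightarrow> real" and g :: "'m \<Rightarrow> complex"
  assumes M: "smooth_manifold M" and U: "open U" "p \<in> U"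
    and f: "smooth_fun_on M U f" and g: "smooth_fun_on M U g"
    and h: "\<And>q. q \<in> U \<Longrightarrow> h q = of_real (f q) * g q"
  shows "dir_deriv M p X h = of_real (f p) * dir_deriv M p X g + of_real (dir_deriv M p X f) * g p"
proof -
  define c where "c = chart_at M p"
  have c: "c \<in> charts_at M p" by (simp add: c_def chart_at[OF M])
  let ?x = "snd c p" and ?f = "f \<circ> chart_inv c" and ?g = "g \<circ> chart_inv c"
  have p: "chart_inv c ?x = p"
    using c by (simp add: charts_at_def chart_inv_left[OF M])
  have df: "(?f has_derivative frechet_derivative ?f (at ?x)) (at ?x)"
    and dg: "(?g has_derivative frechet_derivative ?g (at ?x)) (at ?x)"
    using smooth_fun_on_differentiable[OF f U(2) c] smooth_fun_on_differentiable[OF g U(2) c]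
    by (simp_all only: frechet_derivative_works)
  have D: "((\<lambda>q. of_real (f q) * g q) \<circ> chart_inv c has_derivative
      (\<lambda>v. of_real (f p) * frechet_derivative ?g (at ?x) v
        + of_real (frechet_derivative ?f (at ?x) v) * g p)) (at ?x)"
    using has_derivative_mult[OF bounded_linear.has_derivative[OF bounded_linear_of_real df] dg]
    by (simp add: p comp_def)
  have "frechet_derivative (h \<circ> chart_inv c) (at ?x)
      = frechet_derivative ((\<lambda>q. of_real (f q) * g q) \<circ> chart_inv c) (at ?x)"
    by (rule frechet_derivative_chart_cong[OF M c U _ differentiableI[OF D]]) (simp add: h)
  also have "\<dots> = (\<lambda>v. of_real (f p) * frechet_derivative ?g (at ?x) v
        + of_real (frechet_derivative ?f (at ?x) v) * g p)"
    by (rule frechet_derivative_at[OF D, symmetric])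
  finally show ?thesis by (simp add: dir_deriv_def c_def Let_def)
qed

text \<open>In the local section that \<open>cov_deriv\<close> chooses, only the directional
  derivative differentiates \<open>f\<close>; the connection term merely scales, and the action by
  \<open>matrix_inv S\<close> is linear.\<close>

lemma cov_deriv_mult:
  fixes M :: "('m::topological_space, 's, 'z) spin_spacetime_scheme"
  assumes M: "smooth_manifold M" and spin: "spin_structure M" and U: "open U" "proj M s \<in> U"
    and f: "smooth_fun_on M U f" and \<Phi>: "smooth_section_on M (higher_spin k) U \<Phi>"
  shows "cov_deriv M (higher_spin k) (higher_spin_act_deriv k) X (fun_times_section M f \<Phi>) s i
    = of_real (f (proj M s)) * cov_deriv M (higher_spin k) (higher_spin_act_deriv k) X \<Phi> s i
      + of_real (dir_deriv M (proj M s) X f) * \<Phi> s i"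
proof -
  define p where "p = proj M s"
  define w where "w = (SOME w. w \<in> sections M \<and> p \<in> fst w)"
  define \<sigma> where "\<sigma> = snd w"
  define S where "S = transport M (\<sigma> p) s"
  define B where "B = sl2_lift (connection_matrix M (\<lambda>q. frame_map M (\<sigma> q)) p X)"
  have w: "(fst w, \<sigma>) \<in> sections M" "p \<in> fst w"
    using someI_ex[of "\<lambda>w. w \<in> sections M \<and> p \<in> fst w"] ex_section[OF spin, of p]
    by (auto simp: w_def \<sigma>_def)
  have \<sigma>: "proj M (\<sigma> q) = q" if "q \<in> fst w" for q
    using sections_proj[OF spin w(1) that] .
  have S: "S \<in> SL2C" "act M (\<sigma> p) S = s"
    using transport[OF spin, of "\<sigma> p" s] \<sigma>[OF w(2)] by (simp_all add: S_def p_def)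
  have cov: "cov_deriv M (higher_spin k) (higher_spin_act_deriv k) X \<Psi> s
    = higher_spin_act k (matrix_inv S)
        (\<lambda>i. dir_deriv M p X (\<lambda>q. \<Psi> (\<sigma> q) i) + higher_spin_act_deriv k B (\<Psi> (\<sigma> p)) i)" for \<Psi>
    by (simp add: cov_deriv_def Let_def p_def[symmetric] w_def[symmetric] \<sigma>_def[symmetric]
        transport_def[symmetric] S_def[symmetric] B_def[symmetric] higher_spin_def)
  have O: "open (U \<inter> fst w)" "p \<in> U \<inter> fst w"
    using U w sections_open[OF spin w(1)] by (auto simp: p_def)
  have "smooth_fun_on M (U \<inter> fst w) (\<lambda>q. \<Phi> (\<sigma> q) i)" for i
    using \<Phi> w(1) unfolding smooth_section_on_def by blast
  then have dir: "dir_deriv M p X (\<lambda>q. fun_times_section M f \<Phi> (\<sigma> q) i)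
    = of_real (f p) * dir_deriv M p X (\<lambda>q. \<Phi> (\<sigma> q) i) + of_real (dir_deriv M p X f) * \<Phi> (\<sigma> p) i" for i
    by (intro dir_deriv_mult[OF M O smooth_fun_on_mono[OF f Int_lower1]])
      (auto simp: fun_times_section_def \<sigma>)
  have "fun_times_section M f \<Phi> (\<sigma> p) = (\<lambda>i. of_real (f p) * \<Phi> (\<sigma> p) i)"
    by (simp add: fun_times_section_def \<sigma>[OF w(2)])
  then have "(\<lambda>i. dir_deriv M p X (\<lambda>q. fun_times_section M f \<Phi> (\<sigma> q) i)
      + higher_spin_act_deriv k B (fun_times_section M f \<Phi> (\<sigma> p)) i)
    = (\<lambda>i. of_real (f p) *
        (dir_deriv M p X (\<lambda>q. \<Phi> (\<sigma> q) i) + higher_spin_act_deriv k B (\<Phi> (\<sigma> p)) i)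
      + of_real (dir_deriv M p X f) * \<Phi> (\<sigma> p) i)"
    by (simp add: dir higher_spin_act_deriv_scale algebra_simps)
  then have "cov_deriv M (higher_spin k) (higher_spin_act_deriv k) X (fun_times_section M f \<Phi>) s i
    = of_real (f p) * cov_deriv M (higher_spin k) (higher_spin_act_deriv k) X \<Phi> s i
      + of_real (dir_deriv M p X f) * higher_spin_act k (matrix_inv S) (\<Phi> (\<sigma> p)) i"
    by (simp add: cov higher_spin_act_linear)
  \<comment> \<open>Equivariance of \<open>\<Phi>\<close> turns its components at
    \<open>\<sigma> p\<close> back into those at \<open>s\<close>.\<close>
  moreover have "higher_spin_act k (matrix_inv S) (\<Phi> (\<sigma> p)) = \<Phi> s"
  proof -
    have "proj M (\<sigma> p) \<in> U" using U(2) \<sigma>[OF w(2)] by (simp add: p_def)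
    then have "\<Phi> (act M (\<sigma> p) S) = higher_spin_act k (matrix_inv S) (\<Phi> (\<sigma> p))"
      using \<Phi> S(1) by (simp add: smooth_section_on_def equivariant_over_def higher_spin_def)
    then show ?thesis by (simp add: S(2))
  qed
  ultimately show ?thesis by (simp add: p_def)
qed

text \<open>Feynman slash, twisted by the identity on the multi-indices; \<open>x a\<close> is the
  value of the covector on the frame vector with index \<open>a\<close>.\<close>

definition slash :: "(4 \<Rightarrow> real) \<Rightarrow> (spin_index \<Rightarrow> complex) \<Rightarrow> spin_index \<Rightarrow> complex" where
  "slash x \<phi> = (\<lambda>(i, As, Xs). \<Sum>a\<in>UNIV. \<Sum>j\<in>UNIV. gamma_up a $ i $ j * (of_real (x a) * \<phi> (j, As, Xs)))"

lemma higher_spin_op_mult: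
  fixes M :: "('m::topological_space, 's, 'z) spin_spacetime_scheme"
  assumes "smooth_manifold M" and "spin_structure M" and "open U" and "proj M s \<in> U"
    and "smooth_fun_on M U f" and "smooth_section_on M (higher_spin k) U \<Phi>"
  shows "higher_spin_op M k (fun_times_section M f \<Phi>) s i
      - fun_times_section M f (higher_spin_op M k \<Phi>) s i
    = slash (\<lambda>a. dir_deriv M (proj M s) (frame_map M s a) f) (\<Phi> s) i"
proof -
  obtain j As Xs where i: "i = (j, As, Xs)" by (metis prod_cases3)
  have "fun_times_section M f (higher_spin_op M k \<Phi>) s i
      = of_real (f (proj M s)) * higher_spin_op M k \<Phi> s i"
    by (simp add: fun_times_section_def)
  then show ?thesis
    by (simp add: i higher_spin_op_def cov_deriv_mult[OF assms] slash_def sum_distrib_left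
        sum.distrib algebra_simps)
qed

text \<open>In the chart used by \<open>dir_deriv\<close>, the covector is a linear form
  \<open>L\<close> on components. Applied to the coordinates themselves, \<open>L\<close> is a
  function whose differential is \<open>L\<close>.\<close>

lemma ex_function_with_derivative:
  fixes M :: "('m::topological_space, 'z) spacetime_scheme"
  assumes M: "smooth_manifold M" and \<xi>: "linear_at M p \<xi>"
  shows "\<exists>U f. open U \<and> p \<in> U \<and> smooth_fun_on M U f \<and>
    (\<forall>X\<in>tangent_space M p. dir_deriv M p X f = \<xi> X)"
proof -
  define c where "c = chart_at M p"
  have c: "c \<in> charts_at M p" by (simp add: c_def chart_at[OF M])
  then have ca: "c \<in> atlas M" "p \<in> fst c" "open (fst c)"
    using M by (auto simp: charts_at_def smooth_manifold_def)
  define L where "L v = \<xi> (coord_vec M c p v)" for v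
  have "L (a *\<^sub>R u + b *\<^sub>R v) = a * L u + b * L v" for a b u v
    using \<xi> coord_vec_in_tangent_space[OF M c] coord_vec_linear[OF M c]
    by (simp add: L_def linear_at_def)
  \<comment> \<open>Coefficients 1 and 1 give additivity; second coefficient 0 gives
    homogeneity.\<close>
  from this[of 1 _ 1] this[of _ _ 0] have L: "bounded_linear L"
    unfolding linear_conv_bounded_linear[symmetric] by (intro linearI) auto
  have "smooth_fun_on M (fst c) (snd c)"
    using M ca(1) by (simp add: smooth_fun_on_def smooth_manifold_def)
  then have f: "smooth_fun_on M (fst c) (\<lambda>q. L (snd c q))"
    by (rule smooth_fun_on_bounded_linear[OF M ca(3) L])
  have "dir_deriv M p X (\<lambda>q. L (snd c q)) = \<xi> X" if X: "X \<in> tangent_space M p" for X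
  proof -
    have "(L has_derivative L) (at (snd c p))"
      using L by (rule bounded_linear_imp_has_derivative)
    then have "((\<lambda>q. L (snd c q)) \<circ> chart_inv c has_derivative L) (at (snd c p))"
      by (rule has_derivative_transform_within_open[OF _ open_chart_image[OF M ca(1,3)]])
        (use ca chart_inv_left[OF M ca(1)] in auto)
    then have "dir_deriv M p X (\<lambda>q. L (snd c q)) = L (X c)"
      by (simp add: dir_deriv_def Let_def c_def[symmetric] frechet_derivative_at[symmetric])
    also have "\<dots> = \<xi> X"
      using X c by (auto simp: L_def tangent_space_def)
    finally show ?thesis .
  qed
  then show ?thesis using f ca by blast
qed

text \<open>The definite description needs two facts: all admissible choices of \<open>U\<close>,
  \<open>f\<close> and \<open>\<Phi>\<close> give the same value, by the Leibniz rule, and at least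
  one admissible choice exists.\<close>

lemma principal_symbol_higher_spin_op:
  fixes M :: "('m::topological_space, 's, 'z) spin_spacetime_scheme"
  assumes M: "smooth_manifold M" and spin: "spin_structure M" and \<xi>: "linear_at M p \<xi>"
    and v: "v \<in> fibre M (higher_spin k) p"
  shows "principal_symbol M (higher_spin k) (higher_spin_op M k) p \<xi> v
    = restrict_fibre M p (\<lambda>s. slash (\<lambda>a. \<xi> (frame_map M s a)) (v s))"
proof -
  have frame: "frame_map M s a \<in> tangent_space M (proj M s)" for s a
    using frame_map_oriented[OF spin, of s] by (simp add: oriented_frames_def orthonormal_frame_def)
  have eq: "restrict_fibre M p (\<lambda>s i. higher_spin_op M k (fun_times_section M f \<Phi>) s i
        - fun_times_section M f (higher_spin_op M k \<Phi>) s i)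
      = restrict_fibre M p (\<lambda>s. slash (\<lambda>a. \<xi> (frame_map M s a)) (v s))"
    if *: "open U" "p \<in> U" "smooth_fun_on M U f" "smooth_section_on M (higher_spin k) U \<Phi>"
      "\<forall>X\<in>tangent_space M p. dir_deriv M p X f = \<xi> X" "restrict_fibre M p \<Phi> = v" for U f \<Phi>
  proof
    fix s
    show "restrict_fibre M p (\<lambda>s i. higher_spin_op M k (fun_times_section M f \<Phi>) s i
        - fun_times_section M f (higher_spin_op M k \<Phi>) s i) s
      = restrict_fibre M p (\<lambda>s. slash (\<lambda>a. \<xi> (frame_map M s a)) (v s)) s"
    proof (cases "proj M s = p")
      case True
      have "v s = \<Phi> s" using *(6) True by (auto simp: restrict_fibre_def)
      moreover have "proj M s \<in> U" using True *(2) by simp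
      ultimately show ?thesis
        using True *(5) frame[of s]
        by (simp add: restrict_fibre_def higher_spin_op_mult[OF M spin *(1) _ *(3,4)])
    qed (simp add: restrict_fibre_def)
  qed
  \<comment> \<open>Now one admissible choice is built. Without it the condition under
    \<open>THE\<close> would be vacuous and every \<open>w\<close> would satisfy it.\<close>
  obtain V f where f: "open V" "p \<in> V" "smooth_fun_on M V f"
    "\<forall>X\<in>tangent_space M p. dir_deriv M p X f = \<xi> X"
    using ex_function_with_derivative[OF M \<xi>] by blast
  obtain W \<sigma> where \<sigma>: "(W, \<sigma>) \<in> sections M" "p \<in> W"
    using ex_section[OF spin] by blast
  have \<sigma>p: "proj M (\<sigma> p) = p" using sections_proj[OF spin \<sigma>] .
  have v\<sigma>: "v (\<sigma> p) \<in> higher_spin_space k"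
    using v \<sigma>p by (simp add: fibre_def equivariant_over_def higher_spin_def)
  have U: "open (V \<inter> W)" "p \<in> V \<inter> W" using f \<sigma> sections_open[OF spin \<sigma>(1)] by auto
  note \<Phi> = smooth_extend_section[OF spin M \<sigma>(1) U(1) Int_lower2 v\<sigma>]
  show ?thesis
    unfolding principal_symbol_def
  proof (rule the_equality)
    fix w assume "\<forall>U f \<Phi>. open U \<and> p \<in> U \<and> smooth_fun_on M U f
      \<and> smooth_section_on M (higher_spin k) U \<Phi>
      \<and> (\<forall>X\<in>tangent_space M p. dir_deriv M p X f = \<xi> X) \<and> restrict_fibre M p \<Phi> = v
      \<longrightarrow> w = restrict_fibre M p (\<lambda>s i. higher_spin_op M k (fun_times_section M f \<Phi>) s i
        - fun_times_section M f (higher_spin_op M k \<Phi>) s i)"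
    from this[rule_format, OF conjI[OF U(1) conjI[OF U(2) conjI[OF
            smooth_fun_on_mono[OF f(3) Int_lower1] conjI[OF \<Phi> conjI[OF f(4)
            restrict_fibre_extend_section[where \<sigma> = \<sigma>, OF spin v \<sigma>p]]]]]]]
    show "w = restrict_fibre M p (\<lambda>s. slash (\<lambda>a. \<xi> (frame_map M s a)) (v s))"
      using eq[OF U smooth_fun_on_mono[OF f(3) Int_lower1] \<Phi> f(4)
            restrict_fibre_extend_section[where \<sigma> = \<sigma>, OF spin v \<sigma>p]] by simp
  qed (intro allI impI, elim conjE, rule eq[symmetric])
qed

subsection \<open>The symbol form\<close>

definition slash_block :: "(4 \<Rightarrow> real) \<Rightarrow> 2 + 2 \<Rightarrow> 2 + 2 \<Rightarrow> complex" where
  "slash_block x i j = (\<Sum>a\<in>UNIV. of_real (x a) * gamma_up a $ i $ j)"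

lemma sum_4_zero: "(\<Sum>a\<in>UNIV. f (a::4)) = f 0 + f 1 + f 2 + f 3"
  for f :: "4 \<Rightarrow> 'a::ab_group_add"
proof -
  have "(4::4) = 0" by simp
  then show ?thesis unfolding sum_4 by (simp only: add.commute add.left_commute)
qed

lemma slash_block_diag: "slash_block x (Inl A) (Inl B) = 0" "slash_block x (Inr A) (Inr B) = 0"
  by (auto simp: slash_block_def gamma_up_def gamma_def block_mat_def intro!: sum.neutral)

lemma slash_eq:
  "slash x \<phi> (Inl A, As, Xs) = (\<Sum>B\<in>UNIV. slash_block x (Inl A) (Inr B) * \<phi> (Inr B, As, Xs))"
  "slash x \<phi> (Inr A, As, Xs) = (\<Sum>B\<in>UNIV. slash_block x (Inr A) (Inl B) * \<phi> (Inl B, As, Xs))"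
proof -
  have "slash x \<phi> (i, As, Xs) = (\<Sum>j\<in>UNIV. slash_block x i j * \<phi> (j, As, Xs))" for i
    unfolding slash_def slash_block_def sum_distrib_right
    by (subst sum.swap) (simp add: mult_ac)
  then show "slash x \<phi> (Inl A, As, Xs) = (\<Sum>B\<in>UNIV. slash_block x (Inl A) (Inr B) * \<phi> (Inr B, As, Xs))"
    "slash x \<phi> (Inr A, As, Xs) = (\<Sum>B\<in>UNIV. slash_block x (Inr A) (Inl B) * \<phi> (Inl B, As, Xs))"
    by (simp_all add: sum_UNIV_Plus slash_block_diag)
qed

lemma slash_linear:
  "slash x (\<lambda>i. a * \<phi> i + b * \<psi> i) = (\<lambda>i. a * slash x \<phi> i + b * slash x \<psi> i)"
  by (auto simp: fun_eq_iff slash_def sum_distrib_left sum.distrib algebra_simps)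

lemma cnj_pauli: "cnj (pauli a $ A $ B) = pauli a $ B $ A"
  using exhaust_2[of A] exhaust_2[of B] by (auto simp: pauli_def mat_def)

text \<open>Each off-diagonal block is a real combination of the identity and the Pauli matrices,
  all of them Hermitian.\<close>

lemma cnj_slash_block:
  "cnj (slash_block x (Inl A) (Inr B)) = slash_block x (Inl B) (Inr A)"
  "cnj (slash_block x (Inr A) (Inl B)) = slash_block x (Inr B) (Inl A)"
proof -
  have g: "cnj (gamma a $ Inl A $ Inr B) = gamma a $ Inl B $ Inr A"
    "cnj (gamma a $ Inr A $ Inl B) = gamma a $ Inr B $ Inl A" for a
    by (auto simp: gamma_def block_mat_def cnj_pauli mat_def)
  have "cnj (gamma_up a $ Inl A $ Inr B) = gamma_up a $ Inl B $ Inr A"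
    "cnj (gamma_up a $ Inr A $ Inl B) = gamma_up a $ Inr B $ Inl A" for a
    by (simp_all add: gamma_up_def g)
  then show "cnj (slash_block x (Inl A) (Inr B)) = slash_block x (Inl B) (Inr A)"
    "cnj (slash_block x (Inr A) (Inl B)) = slash_block x (Inr B) (Inl A)"
    by (simp_all add: slash_block_def)
qed

text \<open>Among the identity and the Pauli matrices only the identity and the third Pauli matrix
  have a nonzero upper left entry. Raising the index 3 produces the minus sign.\<close>

lemma slash_block_11:
  "slash_block x (Inl 1) (Inr 1) = of_real ((x 0 - x 3) / sqrt 2)"
proof -
  have g: "gamma_up a $ Inl 1 $ Inr 1 = (if a = 0 then of_real (1 / sqrt 2)
    else if a = 3 then - of_real (1 / sqrt 2) else 0)" for a
  proof -
    have "gamma_up a = (\<Sum>b\<in>UNIV. if b = a then eta a a *\<^sub>R gamma a else 0)"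
      unfolding gamma_up_def by (intro sum.cong) (auto simp: eta_def)
    then have "gamma_up a = eta a a *\<^sub>R gamma a" by simp
    moreover have "pauli a $ 1 $ 1 = (if a = 3 then 1 else 0)" if "a \<noteq> 0"
      using that exhaust_4[of a] by (auto simp: pauli_def)
    ultimately show ?thesis
      by (simp add: eta_def gamma_def block_mat_def mat_def scaleR_conv_of_real[where 'a = complex])
  qed
  have "slash_block x (Inl 1) (Inr 1)
      = of_real (x 0) * of_real (1 / sqrt 2) - of_real (x 3) * of_real (1 / sqrt 2)"
    unfolding slash_block_def sum_4_zero g by simp
  then show ?thesis by (simp add: diff_divide_distrib)
qed

text \<open>Conjugation moves the swapped pair of multi-indices to the other factor. Renaming
  \<open>As\<close> and \<open>Xs\<close> into each other restores the original pattern, and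
  Hermiticity of \<open>P\<close> absorbs the exchange of \<open>A\<close> and
  \<open>B\<close>.\<close>

lemma cnj_swapped_sesquilinear:
  fixes \<phi> \<psi> :: "'i::finite \<Rightarrow> 'b \<Rightarrow> 'b \<Rightarrow> complex"
  assumes "\<And>A B. cnj (P A B) = P B A"
  shows "cnj (\<Sum>A\<in>UNIV. \<Sum>As\<in>I. \<Sum>Xs\<in>I. cnj (\<phi> A Xs As) * (\<Sum>B\<in>UNIV. P A B * \<psi> B As Xs))
    = (\<Sum>A\<in>UNIV. \<Sum>As\<in>I. \<Sum>Xs\<in>I. cnj (\<psi> A Xs As) * (\<Sum>B\<in>UNIV. P A B * \<phi> B As Xs))"
proof -
  have "cnj (\<Sum>A\<in>UNIV. \<Sum>As\<in>I. \<Sum>Xs\<in>I. cnj (\<phi> A Xs As) * (\<Sum>B\<in>UNIV. P A B * \<psi> B As Xs))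
    = (\<Sum>A\<in>UNIV. \<Sum>As\<in>I. \<Sum>Xs\<in>I. \<Sum>B\<in>UNIV. \<phi> A Xs As * P B A * cnj (\<psi> B As Xs))"
    by (simp add: assms sum_distrib_left mult.assoc)
  also have "\<dots> = (\<Sum>A\<in>UNIV. \<Sum>Xs\<in>I. \<Sum>As\<in>I. \<Sum>B\<in>UNIV. \<phi> A Xs As * P B A * cnj (\<psi> B As Xs))"
    by (intro sum.cong refl sum.swap)
  also have "\<dots> = (\<Sum>A\<in>UNIV. \<Sum>B\<in>UNIV. \<Sum>Xs\<in>I. \<Sum>As\<in>I. \<phi> A Xs As * P B A * cnj (\<psi> B As Xs))"
    by (simp only: sum.swap[of _ UNIV I])
  also have "\<dots> = (\<Sum>B\<in>UNIV. \<Sum>A\<in>UNIV. \<Sum>Xs\<in>I. \<Sum>As\<in>I. \<phi> A Xs As * P B A * cnj (\<psi> B As Xs))"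
    by (rule sum.swap)
  also have "\<dots> = (\<Sum>A\<in>UNIV. \<Sum>As\<in>I. \<Sum>Xs\<in>I. cnj (\<psi> A Xs As) * (\<Sum>B\<in>UNIV. P A B * \<phi> B As Xs))"
    unfolding sum_distrib_left by (simp only: sum.swap[of _ UNIV I] mult_ac)
  finally show ?thesis .
qed

text \<open>As \<open>slash\<close> exchanges the two chiralities, the first sum pairs
  \<open>Inr\<close> components with \<open>Inr\<close> components and the second \<open>Inl\<close>
  with \<open>Inl\<close>, so each sum is Hermitian by itself.\<close>

lemma component_product_slash_hermitian:
  "component_product k \<psi> (slash x \<phi>) = cnj (component_product k \<phi> (slash x \<psi>))"
  unfolding component_product_def slash_eq complex_cnj_add
  using cnj_swapped_sesquilinear[where P = "\<lambda>A B. slash_block x (Inl A) (Inr B)"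
      and \<phi> = "\<lambda>A Xs As. \<phi> (Inr A, Xs, As)" and \<psi> = "\<lambda>A Xs As. \<psi> (Inr A, Xs, As)"
      and I = "multi_index k", OF cnj_slash_block(1)]
    cnj_swapped_sesquilinear[where P = "\<lambda>A B. slash_block x (Inr A) (Inl B)"
      and \<phi> = "\<lambda>A Xs As. \<phi> (Inl A, Xs, As)" and \<psi> = "\<lambda>A Xs As. \<psi> (Inl A, Xs, As)"
      and I = "multi_index k", OF cnj_slash_block(2)]
  by simp

lemma component_product_linear:
  "component_product k \<phi> (\<lambda>i. a * \<psi> i + b * \<theta> i)
    = a * component_product k \<phi> \<psi> + b * component_product k \<phi> \<theta>"
  by (simp add: component_product_def sum_distrib_left sum.distrib algebra_simps)

text \<open>Placing the Dirac index at \<open>Inr 1\<close> leaves only the first sum of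
  \<open>component_product\<close>, and in it the single entry
  \<open>slash_block x (Inl 1) (Inr 1)\<close>.\<close>

definition twisted_spinor :: "nat \<Rightarrow> real \<Rightarrow> spin_index \<Rightarrow> complex" where
  "twisted_spinor k \<epsilon> = (\<lambda>(i, As, Xs). if i = Inr 1 then
     of_bool (As = replicate k 1 \<and> Xs = replicate k 2)
       + of_real \<epsilon> * of_bool (As = replicate k 2 \<and> Xs = replicate k 1) else 0)"

text \<open>A constant list has no other rearrangement, so tensors supported on constant
  multi-indices are already symmetric.\<close>

lemma mset_eq_replicate: "mset As = mset As' \<Longrightarrow> As = replicate k b \<longleftrightarrow> As' = replicate k b"
  by (metis mset_eq_length mset_eq_setD replicate_eqI length_replicate in_set_replicate)

lemma twisted_spinor_in_space: "twisted_spinor k \<epsilon> \<in> higher_spin_space k"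
proof (rule higher_spin_spaceI)
  show "twisted_spinor k \<epsilon> (i, As, Xs) = twisted_spinor k \<epsilon> (i, As', Xs')"
    if "mset As = mset As'" "mset Xs = mset Xs'" for i As Xs As' Xs'
    using mset_eq_replicate[OF that(1)] mset_eq_replicate[OF that(2)]
    by (simp add: twisted_spinor_def)
qed (auto simp: twisted_spinor_def multi_index_def)

lemma component_product_twisted_spinor:
  assumes "k \<ge> 1" and "\<epsilon> = 1 \<or> \<epsilon> = -1"
  shows "component_product k (twisted_spinor k \<epsilon>) (slash x (twisted_spinor k \<epsilon>))
    = of_real (\<epsilon> * (2 * ((x 0 - x 3) / sqrt 2)))"
proof -
  let ?u = "replicate k 1 :: 2 list" and ?d = "replicate k 2 :: 2 list"
  let ?t = "twisted_spinor k \<epsilon>" and ?P = "slash_block x (Inl 1) (Inr 1)"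
  \<comment> \<open>For \<open>k = 0\<close> both lists would be empty, and the two terms of the
    spinor would sit at the same index.\<close>
  have ud: "?u \<noteq> ?d" using assms(1) by simp
  have mi: "?u \<in> multi_index k" "?d \<in> multi_index k" by (simp_all add: multi_index_def)
  have t2: "?t (Inr 2, As, Xs) = 0" and tl: "?t (Inl A, As, Xs) = 0" for A As Xs
    by (simp_all add: twisted_spinor_def)
  have U: "(UNIV :: 2 set) = {1, 2}" using UNIV_2 .
  \<comment> \<open>Because the conjugated factor has its multi-indices swapped, each of the two
    terms of the spinor meets only the other one. Both cross terms carry the coefficient
    \<open>\<epsilon>\<close>, and there are no squares.\<close>
  have summand: "cnj (?t (Inr 1, Xs, As)) * (?P * ?t (Inr 1, As, Xs))
    = (if As = ?u then if Xs = ?d then of_real \<epsilon> * ?P else 0 else 0)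
      + (if As = ?d then if Xs = ?u then of_real \<epsilon> * ?P else 0 else 0)" for As Xs
    using ud assms(2) by (auto simp: twisted_spinor_def)
  have "component_product k ?t (slash x ?t) =
    (\<Sum>As\<in>multi_index k. \<Sum>Xs\<in>multi_index k. cnj (?t (Inr 1, Xs, As)) * (?P * ?t (Inr 1, As, Xs)))"
    unfolding component_product_def slash_eq U by (simp add: t2 tl)
  also have "\<dots> = of_real \<epsilon> * ?P + of_real \<epsilon> * ?P"
  proof -
    have *: "(\<Sum>As\<in>multi_index k. \<Sum>Xs\<in>multi_index k.
        if As = a then if Xs = b then c else 0 else 0) = c"
      if "a \<in> multi_index k" "b \<in> multi_index k" for a b and c :: complex
    proof -
      have "(\<Sum>Xs\<in>multi_index k. if As = a then if Xs = b then c else 0 else 0)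
        = (if As = a then c else 0)" for As
        using that by (simp add: finite_multi_index)
      then show ?thesis using that by (simp add: finite_multi_index)
    qed
    show ?thesis unfolding summand sum.distrib *[OF mi] *[OF mi(2,1)] ..
  qed
  finally show ?thesis by (simp add: slash_block_11)
qed

text \<open>In an orthonormal frame, \<open>metric M p X X\<close> is the square of the 0-component
  minus those of the others, and lowering an index changes signs only. The result keeps the factor
  \<open>x 0 - x 3\<close> of the test value away from 0.\<close>

lemma timelike_frame_components:
  fixes M :: "('m::topological_space, 'z) spacetime_scheme"
  assumes M: "smooth_manifold M" and L: "lorentz_metric M"
    and e: "orthonormal_frame M p e" and X: "timelike M p X"
  shows "(metric M p X (e 3))\<^sup>2 < (metric M p X (e 0))\<^sup>2"
proof -
  have XT: "X \<in> tangent_space M p" and eT: "\<And>a. e a \<in> tangent_space M p"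
    using X e by (auto simp: timelike_def orthonormal_frame_def)
  have lin: "linear_at M p (metric M p Y)" if "Y \<in> tangent_space M p" for Y
    using L that by (simp add: lorentz_metric_def)
  have sym: "metric M p Y Z = metric M p Z Y"
    if "Y \<in> tangent_space M p" "Z \<in> tangent_space M p" for Y Z
    using L that by (simp add: lorentz_metric_def)
  obtain x :: "real^4" where x: "X = (\<lambda>c. \<Sum>a\<in>UNIV. x$a *\<^sub>R e a c)"
    using e XT unfolding orthonormal_frame_def by blast
  have expand: "metric M p Y X = (\<Sum>a\<in>UNIV. x$a * metric M p Y (e a))"
    if "Y \<in> tangent_space M p" for Y
    using linear_at_sum[OF M lin[OF that] finite eT, of "\<lambda>a. x$a"] by (simp add: x)
  have comp: "metric M p X (e a) = eta a a * x$a" for a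
  proof -
    have "metric M p X (e a) = (\<Sum>b\<in>UNIV. x$b * eta a b)"
      using e by (simp add: sym[OF XT eT] expand[OF eT] orthonormal_frame_def)
    also have "\<dots> = (\<Sum>b\<in>UNIV. if b = a then eta a a * x$a else 0)"
      by (intro sum.cong) (auto simp: eta_def)
    finally show ?thesis by simp
  qed
  have "0 < metric M p X X" using X by (simp add: timelike_def)
  also have "\<dots> = (x$0)\<^sup>2 - (x$1)\<^sup>2 - (x$2)\<^sup>2 - (x$3)\<^sup>2"
    unfolding expand[OF XT] comp sum_4_zero by (simp add: eta_def power2_eq_square)
  finally have "(x$3)\<^sup>2 < (x$0)\<^sup>2"
    using zero_le_power2[of "x$1"] zero_le_power2[of "x$2"] by linarith
  then show ?thesis by (simp add: comp eta_def)
qed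

text \<open>\<open>s\<close> is the point that \<open>higher_spin_product\<close> selects; a local
  section shows that the fibre is nonempty, so it does lie over \<open>p\<close>. The whole form is
  thereby computed in one spin frame.\<close>

lemma symbol_form_higher_spin:
  fixes M :: "('m::topological_space, 's, 'z) spin_spacetime_scheme"
  assumes M: "smooth_manifold M" and spin: "spin_structure M" and \<xi>: "linear_at M p (\<xi> p)"
  shows "\<exists>s. proj M s = p \<and> (\<forall>u. \<forall>v\<in>fibre M (higher_spin k) p.
      symbol_form M (higher_spin k) (higher_spin_op M k) (higher_spin_product M k) \<xi> p u v
        = component_product k (u s) (slash (\<lambda>a. \<xi> p (frame_map M s a)) (v s)))"
proof -
  define s where "s = (SOME s. proj M s = p)"
  obtain U \<sigma> where \<sigma>: "(U, \<sigma>) \<in> sections M" "p \<in> U"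
    using ex_section[OF spin] by blast
  have s: "proj M s = p"
    using someI[of "\<lambda>s. proj M s = p", OF sections_proj[OF spin \<sigma>]] by (simp add: s_def)
  have "symbol_form M (higher_spin k) (higher_spin_op M k) (higher_spin_product M k) \<xi> p u v
        = component_product k (u s) (slash (\<lambda>a. \<xi> p (frame_map M s a)) (v s))"
    if "v \<in> fibre M (higher_spin k) p" for u v
    using s by (simp add: symbol_form_def higher_spin_product_def Let_def s_def[symmetric]
        principal_symbol_higher_spin_op[OF M spin \<xi> that] restrict_fibre_def)
  with s show ?thesis by blast
qed

lemma fibre_linear:
  assumes "u \<in> fibre M (higher_spin k) p" and "v \<in> fibre M (higher_spin k) p"
  shows "(\<lambda>s i. a * u s i + b * v s i) \<in> fibre M (higher_spin k) p"
  using assms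
  by (simp add: fibre_def equivariant_over_def higher_spin_def higher_spin_space_linear
      higher_spin_act_linear)

lemma symbol_form_hermitian_indefinite:
  fixes M :: "('m::{t2_space, second_countable_topology}, 's, 'z) spin_spacetime_scheme"
  assumes ST: "spacetime_manifold M" and spin: "spin_structure M" and k: "k \<ge> 1"
    and lin: "linear_at M p (\<xi> p)" and \<xi>: "future_timelike_covector M p (\<xi> p)"
  defines "h \<equiv> symbol_form M (higher_spin k) (higher_spin_op M k) (higher_spin_product M k) \<xi> p"
  shows "hermitian_on (fibre M (higher_spin k) p) h" and "indefinite_on (fibre M (higher_spin k) p) h"
proof -
  have M: "smooth_manifold M" and L: "lorentz_metric M"
    using ST by (simp_all add: spacetime_manifold_def)
  have "\<exists>s. proj M s = p \<and> (\<forall>u. \<forall>v\<in>fibre M (higher_spin k) p.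
      h u v = component_product k (u s) (slash (\<lambda>a. \<xi> p (frame_map M s a)) (v s)))"
    unfolding h_def by (rule symbol_form_higher_spin[where \<xi> = \<xi>, OF M spin lin])
  then obtain s where s: "proj M s = p" and form: "\<And>u v. v \<in> fibre M (higher_spin k) p \<Longrightarrow>
      h u v = component_product k (u s) (slash (\<lambda>a. \<xi> p (frame_map M s a)) (v s))"
    by blast
  show "hermitian_on (fibre M (higher_spin k) p) h"
    unfolding hermitian_on_def
  proof (intro conjI ballI allI)
    fix u v w a b
    assume F: "u \<in> fibre M (higher_spin k) p" "v \<in> fibre M (higher_spin k) p"
    show "h v u = cnj (h u v)"
      unfolding form[OF F(1)] form[OF F(2)] by (rule component_product_slash_hermitian)
    assume "w \<in> fibre M (higher_spin k) p"
    with F show "h u (\<lambda>s i. a * v s i + b * w s i) = a * h u v + b * h u w"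
      by (simp add: form fibre_linear slash_linear component_product_linear)
  qed
  let ?x = "\<lambda>a. \<xi> p (frame_map M s a)"
  \<comment> \<open>The value of the form on \<open>twisted_spinor k 1\<close>; with
    \<open>\<epsilon> = -1\<close> it becomes \<open>-c\<close>.\<close>
  define c where "c = 2 * ((?x 0 - ?x 3) / sqrt 2)"
  have "orthonormal_frame M p (frame_map M s)"
    using frame_map_oriented[OF spin, of s] s by (simp add: oriented_frames_def)
  moreover obtain X where "timelike M p X" "\<forall>Y\<in>tangent_space M p. \<xi> p Y = metric M p X Y"
    using \<xi> unfolding future_timelike_covector_def by blast
  ultimately have "(?x 3)\<^sup>2 < (?x 0)\<^sup>2"
    using timelike_frame_components[OF M L] by (simp add: orthonormal_frame_def)
  \<comment> \<open>Equal components 0 and 3 would have equal squares.\<close>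
  then have c: "c \<noteq> 0" by (auto simp: c_def)
  have ex: "\<exists>v\<in>fibre M (higher_spin k) p. h v v \<in> \<real> \<and> Re (h v v) = \<epsilon> * c" if "\<epsilon> = 1 \<or> \<epsilon> = -1" for \<epsilon>
  proof -
    obtain v where v: "v \<in> fibre M (higher_spin k) p" "v s = twisted_spinor k \<epsilon>"
      using ex_fibre_value[OF spin twisted_spinor_in_space[of k \<epsilon>], where s = s] s by blast
    have "h v v = of_real (\<epsilon> * c)"
      unfolding form[OF v(1)] v(2) c_def by (rule component_product_twisted_spinor[OF k that])
    then have "h v v \<in> \<real> \<and> Re (h v v) = \<epsilon> * c" by (simp only: Reals_of_real Re_complex_of_real)
    with v(1) show ?thesis by blast
  qed
  show "indefinite_on (fibre M (higher_spin k) p) h"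
    \<comment> \<open>Both \<open>c\<close> and \<open>-c\<close> are attained; the sign of
      \<open>c\<close> decides which spinor serves for which half.\<close>
    unfolding indefinite_on_def using ex[of 1] ex[of "-1"] c
    by (cases "c > 0") force+
qed

theorem mainTheorem4:
  fixes M :: "('m::{t2_space, second_countable_topology}, 's) spin_spacetime"
    and k :: nat
  assumes "spacetime_manifold M"
    and "spin_structure M"
    and "k \<ge> 2"
  shows "(\<forall>\<xi>. smooth_covector_field M \<xi> \<and> nowhere_vanishing M \<xi> \<and>
            (\<forall>p. future_timelike_covector M p (\<xi> p)) \<longrightarrow>
            (\<forall>p. hermitian_on (fibre M (higher_spin k) p)
                   (symbol_form M (higher_spin k) (higher_spin_op M k) (higher_spin_product M k) \<xi> p) \<and>
                 indefinite_on (fibre M (higher_spin k) p)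
                   (symbol_form M (higher_spin k) (higher_spin_op M k) (higher_spin_product M k) \<xi> p)))
       \<and> indefinite_type M (higher_spin k) (higher_spin_op M k) (higher_spin_product M k)"
proof -
  \<comment> \<open>Stated for the class of covector fields over which
    \<open>indefinite_type\<close> quantifies, so that both conjuncts of the goal are
    instances.\<close>
  have "hermitian_on (fibre M (higher_spin k) p)
          (symbol_form M (higher_spin k) (higher_spin_op M k) (higher_spin_product M k) \<xi> p) \<and>
        indefinite_on (fibre M (higher_spin k) p)
          (symbol_form M (higher_spin k) (higher_spin_op M k) (higher_spin_product M k) \<xi> p)"
    if "smooth_covector_field M \<xi>" "\<forall>p. future_timelike_covector M p (\<xi> p)" for \<xi> p
  proof -
    have "linear_at M p (\<xi> p)" using that(1) by (simp add: smooth_covector_field_def)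
    moreover have "k \<ge> 1" using assms(3) by simp
    ultimately show ?thesis
      using symbol_form_hermitian_indefinite[OF assms(1,2)] that(2) by blast
  qed
  then show ?thesis by (simp add: indefinite_type_def)
qed

end
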